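(* Consider the model $$Y_i=f_n(X_i)+\epsilon_i=\sum_{j=1}^{p_n}\beta_{n,j}X_{i,j}+\epsilon_i,\qquad i=1,\dots,n,$$ with random design: the $X_i\in\mathbb{R}^{p_n}$ are i.i.d. with $\mathbb{E}[|X_{1,j}|^2]=1$ for all $j=1,\dots,p_n$, and the error terms $\epsilon_1,\dots,\epsilon_n$ are i.i.d., independent of all $X_i$, and mean-centered. Let $X$ denote a new observation which follows the same distribution as the $X_i$, independently of all $X_i$. Assume: (E1) There exist $\xi\in(0,1)$ and $C\in(0,\infty)$ such that $p_n=\mathcal{O}(\exp(Cn^{1-\xi}))$ for $n\to\infty$. (E2) $\sup_n\left(\sum_{j=1}^{p_n}|\beta_{n,j}|\right)<\infty$. (E3) $\sup_{j,n}\|X_{1,j}\|_\infty<\infty$, where $\|\cdot\|_\infty$ is the (essential) supremum norm of the random variable. (E4) $\mathbb{E}[|\epsilon_1|^\delta]<\infty$ for some $\delta>4/\xi$, with $\xi$ from (E1). (E5) (Corr-min condition) There exists $a>0$ such that for all $m,n$ there exists $\tilde C\ge a$ with $$\left|\langle \hat R_n^{m-1}f,g_{\hat j_m}\rangle_{(n)}\right|\ \ge\ \tilde C\,\sup_j\left|\langle \hat R_n^{m-1}f,g_j\rangle_{(n)}\right|,$$ where $f=f_n$, $\hat j_m$ is the variable selected by SingBoost in its $m$-th iteration, and $\hat R_n^{m}f$ are the empirical residuals of the associated iterative scheme. Let $\hat f_n^{(m)}$ denote the SingBoost model after the $m$-th iteration based on $n$ observations. Then $$\mathbb{E}_X\left[|\hat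 f_n^{(m_n)}(X)-f_n(X)|^2\right]=o_P(n^0)=o_P(1)\qquad (n\to\infty),$$ provided that the sequence $(m_n)_n$ satisfies $m_n\to\infty$ sufficiently slowly for $n\to\infty$. Here $\mathbb{E}_X$ is the expectation over the new observation $X$ only, with the training data held fixed.
   Context: Notation. $X_{i,j}$ is the $j$-th component of the $i$-th observation. Empirical inner product: $\langle f,g\rangle_{(n)}=\frac1n\sum_{i=1}^n f(X_i)g(X_i)$, and $\langle Y,g\rangle_{(n)}=\frac1n\sum_{i=1}^n Y_ig(X_i)$; likewise for a vector of residuals in place of $Y$. For each variable $j$, $g_j$ is the (linear) baselearner with respect to variable $j$, i.e. $g_j(x)=x_j$ for $x=(x_1,\dots,x_{p_n})$; it is assumed that $\langle g_j,g_j\rangle_{(n)}=1$ for all $j$. $L_2$-Boosting (componentwise least squares Boosting). Given the current model $\hat f^{(m-1)}$ with residuals $r_i^{(m-1)}=Y_i-\hat f^{(m-1)}(X_i)$, fit for each variable $j$ a simple least squares model to the residuals using variable $j$ only (its fitted function is $\langle r^{(m-1)},g_j\rangle_{(n)}\,g_j$), select the variable $\hat j_m$ with smallest residual sum of squares (equivalently with the largest $|\langle r^{(m-1)},g_j\rangle_{(n)}|$), and update $\hat f^{(m)}=\hat f^{(m-1)}+\kappa\,\langle r^{(m-1)},g_{\hat j_m}\rangle_{(n)}\,g_{\hat j_m}$ with step size $\kappa\in(0,1]$. SingBoost. Let $\tilde L$ be a target loss function (no differentiability or continuity is required) and let $M\in\mathbb{N}$. SingBoost starts with $\hat f^{(0)}=0$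 and performs the same kind of iterations as $L_2$-Boosting, except that every $M$-th iteration (the iterations $m=(k-1)M+1$, $k=1,2,\dots$) is a "singular iteration": there, all simple least squares fits (one per variable $j$) on the current residuals are computed and evaluated with respect to $\tilde L$, and $\hat j_m$ is the variable whose fit is best, i.e. attains the smallest empirical target loss. The model is then updated with the least squares fit of the selected variable, i.e. $\hat f^{(m)}=\hat f^{(m-1)}+\kappa\,\langle r^{(m-1)},g_{\hat j_m}\rangle_{(n)}\,g_{\hat j_m}$ with step size $\kappa\in(0,1]$. The $M-1$ iterations following each singular iteration are ordinary $L_2$-Boosting steps. Thus SingBoost differs from $L_2$-Boosting only in the variable selection in the singular iterations. Iterative scheme. With step size $\kappa=1$, and with the selected variables $\hat j_1,\hat j_2,\dots$, the empirical residuals $\hat R_n^m f$ are given by $$\hat R_n^0f=f,\qquad \hat R_n^1f=f-\langle Y,g_{\hat j_1}\rangle_{(n)}g_{\hat j_1},\qquad \hat R_n^mf=\hat R_n^{m-1}f-\langle \hat R_n^{m-1}f,g_{\hat j_m}\rangle_{(n)}g_{\hat j_m}\quad (m\ge2).$$ The result is formulated for this scheme, i.e. for step size $\kappa=1$. "$m_n\to\infty$ sufficiently slowly" means: there is a sequence $r_n\to\infty$ such that the conclusion holds for every sequence of iteration numbers $m_n\to\infty$ with $m_n\le r_n$. *)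

theory Defs
  imports "HOL-Probability.Probability" "HOL-Library.Landau_Symbols"
begin

text \<open>
  A covariate vector in \<open>\<real>\<^sup>p\<close> is a function \<open>nat \<Rightarrow> real\<close> whose components are the values at
  \<open>1, \<dots>, p\<close>. A sample of size \<open>n\<close> is a family of such vectors \<open>x i\<close>, or of responses \<open>y i\<close>,
  with \<open>1 \<le> i \<le> n\<close>; only these indices are used.

  Points of \<open>covar_space p\<close> are extensional (fixed to \<open>undefined\<close> outside \<open>{1..p}\<close>), so
  a random vector with values in \<open>\<real>\<^sup>p\<close> is a measurable map into \<open>covar_space p\<close>.
\<close>

abbreviation covar_space :: "nat \<Rightarrow> (nat \<Rightarrow> real) measure" where
  "covar_space p \<equiv> (\<Pi>\<^sub>M j\<in>{1..p}. borel)"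

text \<open>
  Independence of two random variables with values in spaces of different types
  (\<^const>\<open>prob_space.indep_var\<close> needs both to have the same type).
\<close>

definition indep_rv ::
  "'a measure \<Rightarrow> 'b measure \<Rightarrow> ('a \<Rightarrow> 'b) \<Rightarrow> 'c measure \<Rightarrow> ('a \<Rightarrow> 'c) \<Rightarrow> bool" where
  "indep_rv P A U B V \<longleftrightarrow>
     U \<in> measurable P A \<and> V \<in> measurable P B \<and>
     prob_space.indep_set P (sets (vimage_algebra (space P) U A)) (sets (vimage_algebra (space P) V B))"

text \<open>\<open>Z n = o\<^sub>P(1)\<close>; the \<open>Z n\<close> are required to be random variables for all large \<open>n\<close>.\<close>

definition small_o_P_one :: "'a measure \<Rightarrow> (nat \<Rightarrow> 'a \<Rightarrow> real) \<Rightarrow> bool" where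
  "small_o_P_one P Z \<longleftrightarrow>
     (\<forall>\<^sub>F n in sequentially. Z n \<in> borel_measurable P) \<and>
     (\<forall>\<eta>>0. (\<lambda>n. measure P {\<omega> \<in> space P. \<bar>Z n \<omega>\<bar> > \<eta>}) \<longlonglongrightarrow> 0)"

definition baselearner :: "nat \<Rightarrow> (nat \<Rightarrow> real) \<Rightarrow> real" where
  "baselearner j z = z j"

definition linear_model :: "nat \<Rightarrow> (nat \<Rightarrow> real) \<Rightarrow> (nat \<Rightarrow> real) \<Rightarrow> real" where
  "linear_model p b z = (\<Sum>j\<in>{1..p}. b j * z j)"

text \<open>
  The empirical inner product takes the two vectors of values at the observations, so that
  it covers both \<open>\<langle>f,g\<rangle>\<close> (with \<open>u i = f (x i)\<close>) and \<open>\<langle>Y,g\<rangle>\<close> (with \<open>u i = y i\<close>).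
\<close>

definition emp_inner :: "nat \<Rightarrow> (nat \<Rightarrow> real) \<Rightarrow> (nat \<Rightarrow> real) \<Rightarrow> real" where
  "emp_inner n u v = 1 / real n * (\<Sum>i\<in>{1..n}. u i * v i)"

text \<open>
  Simple least squares fit of the responses \<open>r\<close> on variable \<open>j\<close>, for baselearners of empirical
  norm one (in general the coefficient would be divided by \<open>\<langle>g\<^sub>j,g\<^sub>j\<rangle>\<close>).
\<close>

definition ls_fit ::
  "nat \<Rightarrow> (nat \<Rightarrow> nat \<Rightarrow> real) \<Rightarrow> (nat \<Rightarrow> real) \<Rightarrow> nat \<Rightarrow> (nat \<Rightarrow> real) \<Rightarrow> real" where
  "ls_fit n x r j z = emp_inner n r (\<lambda>i. baselearner j (x i)) * baselearner j z"

text \<open>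
  Boosting model after \<open>m\<close> iterations with step size \<open>\<kappa>\<close>, where \<open>s m\<close> is the variable selected
  in iteration \<open>m \<ge> 1\<close>.
\<close>

primrec boost_model ::
  "real \<Rightarrow> nat \<Rightarrow> (nat \<Rightarrow> nat \<Rightarrow> real) \<Rightarrow> (nat \<Rightarrow> real) \<Rightarrow> (nat \<Rightarrow> nat) \<Rightarrow> nat
     \<Rightarrow> (nat \<Rightarrow> real) \<Rightarrow> real" where
  "boost_model \<kappa> n x y s 0 = (\<lambda>z. 0)"
| "boost_model \<kappa> n x y s (Suc m) =
     (\<lambda>z. boost_model \<kappa> n x y s m z
          + \<kappa> * ls_fit n x (\<lambda>i. y i - boost_model \<kappa> n x y s m (x i)) (s (Suc m)) z)"

definition boost_resid ::
  "real \<Rightarrow> nat \<Rightarrow> (nat \<Rightarrow> nat \<Rightarrow> real) \<Rightarrow> (nat \<Rightarrow> real) \<Rightarrow> (nat \<Rightarrow> nat) \<Rightarrow> nat \<Rightarrow> nat \<Rightarrow> real" where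
  "boost_resid \<kappa> n x y s m i = y i - boost_model \<kappa> n x y s m (x i)"

definition fit_rss ::
  "nat \<Rightarrow> (nat \<Rightarrow> nat \<Rightarrow> real) \<Rightarrow> (nat \<Rightarrow> real) \<Rightarrow> nat \<Rightarrow> real" where
  "fit_rss n x r j = (\<Sum>i\<in>{1..n}. (r i - ls_fit n x r j (x i))\<^sup>2)"

text \<open>
  A target loss is an arbitrary function \<open>L\<close> giving the empirical loss \<open>L [y\<^sub>1,\<dots>,y\<^sub>n] [z\<^sub>1,\<dots>,z\<^sub>n]\<close>
  of the predictions \<open>z\<close> for the responses \<open>y\<close>: for instance the mean of a pointwise loss
  \<open>l y\<^sub>i z\<^sub>i\<close>, or a ranking loss, which is not of this form.
\<close>

definition fit_target_loss ::
  "(real list \<Rightarrow> real list \<Rightarrow> real) \<Rightarrow> nat \<Rightarrow> (nat \<Rightarrow> nat \<Rightarrow> real) \<Rightarrow> (nat \<Rightarrow> real) \<Rightarrow> nat \<Rightarrow> real" where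
  "fit_target_loss L n x r j = L (map r [1..<n+1]) (map (\<lambda>i. ls_fit n x r j (x i)) [1..<n+1])"

definition singular_iteration :: "nat \<Rightarrow> nat \<Rightarrow> bool" where
  "singular_iteration M m \<longleftrightarrow> (\<exists>k\<ge>1. m = (k - 1) * M + 1)"

text \<open>
  \<open>s 1, s 2, \<dots>\<close> are variables selected by SingBoost on the data \<open>(x, y)\<close> with \<open>p\<close> variables;
  ties may be broken arbitrarily.
\<close>

definition singboost_selection ::
  "(real list \<Rightarrow> real list \<Rightarrow> real) \<Rightarrow> nat \<Rightarrow> real \<Rightarrow> nat \<Rightarrow> nat
     \<Rightarrow> (nat \<Rightarrow> nat \<Rightarrow> real) \<Rightarrow> (nat \<Rightarrow> real) \<Rightarrow> (nat \<Rightarrow> nat) \<Rightarrow> bool" where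
  "singboost_selection L M \<kappa> n p x y s \<longleftrightarrow>
     (\<forall>m\<ge>1. let r = boost_resid \<kappa> n x y s (m - 1) in
        is_arg_min (if singular_iteration M m then fit_target_loss L n x r else fit_rss n x r)
          (\<lambda>j. j \<in> {1..p}) (s m))"

text \<open>
  The empirical residuals \<open>R\<^sup>m f\<close> of the iterative scheme (step size one). The first step
  projects the responses \<open>y\<close>, the later ones the previous residual function; \<open>R\<^sup>m f\<close> is therefore in
  general not \<open>f\<close> minus the boosting model.
\<close>

fun emp_scheme ::
  "nat \<Rightarrow> (nat \<Rightarrow> nat \<Rightarrow> real) \<Rightarrow> (nat \<Rightarrow> real) \<Rightarrow> (nat \<Rightarrow> nat) \<Rightarrow> ((nat \<Rightarrow> real) \<Rightarrow> real) \<Rightarrow> nat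
     \<Rightarrow> (nat \<Rightarrow> real) \<Rightarrow> real" where
  "emp_scheme n x y s f 0 = f"
| "emp_scheme n x y s f (Suc 0) =
     (\<lambda>z. f z - emp_inner n y (\<lambda>i. baselearner (s 1) (x i)) * baselearner (s 1) z)"
| "emp_scheme n x y s f (Suc (Suc m)) =
     (\<lambda>z. emp_scheme n x y s f (Suc m) z
          - emp_inner n (\<lambda>i. emp_scheme n x y s f (Suc m) (x i))
              (\<lambda>i. baselearner (s (Suc (Suc m))) (x i))
            * baselearner (s (Suc (Suc m))) z)"

end

theory Submission
  imports Defs "HOL-Real_Asymp.Real_Asymp"
begin

text \<open>
  Why the theorem holds. Fix \<open>n\<close> and write \<open>D\<^sup>m = f - f\<^sup>m\<close> for the error of the boosting model
  after \<open>m\<close> steps and \<open>\<zeta> = max\<^sub>j |\<langle>\<epsilon>,g\<^sub>j\<rangle>|\<close> for the largest empirical correlation of the noise with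
  a baselearner. Three observations are combined.

  First, \<open>D\<^sup>1 = R\<^sup>1\<close>, and afterwards the recursions of \<open>D\<^sup>m\<close> and of the scheme \<open>R\<^sup>m\<close> differ only by
  the term \<open>\<langle>\<epsilon>,g\<rangle>g\<close>. Since \<open>|\<langle>g\<^sub>j,g\<^sub>k\<rangle>| \<le> 1\<close>, the coefficients of \<open>D\<^sup>m - R\<^sup>m\<close> have
  \<open>\<ell>\<^sup>1\<close>-norm at most \<open>2\<^sup>m\<zeta>\<close> (\<open>boosting_error_minus_scheme\<close>). This is exponential in \<open>m\<close>, but \<open>m\<close> may
  grow as slowly as needed.

  Second, from \<open>m = 1\<close> on the scheme is, by the corr-min condition, a weak greedy algorithm in the
  finite-dimensional space of linear models with the empirical inner product, with the
  weakness parameter \<open>a\<close>. Hence its empirical norm tends to zero at a rate that depends only on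
  \<open>a\<close> and on the \<open>\<ell>\<^sup>1\<close>-norm of the coefficients of \<open>R\<^sup>1\<close> (\<open>weak_greedy_bounds\<close>). The corr-min
  condition covers the singular iterations and the least squares iterations alike.

  Third, the squared empirical norm and the prediction error \<open>E|h(X)|\<^sup>2\<close> of a linear model \<open>h\<close> differ
  by at most the squared \<open>\<ell>\<^sup>1\<close>-norm of its coefficients times the largest deviation of an
  empirical second moment from its expectation (\<open>l1_ball_moment_deviation\<close>).

  It remains to see that \<open>\<zeta>\<close> and the largest deviation of the second moments tend to zero in
  probability although \<open>p\<close> may grow like \<open>exp(C n\<^sup>1\<^sup>-\<^sup>\<xi>)\<close>. Both follow from Hoeffding's inequality and
  a union bound; the noise is truncated at level \<open>n\<^sup>\<xi>\<^sup>/\<^sup>4\<close>, which leaves the exponent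
  \<open>n\<^sup>1\<^sup>-\<^sup>\<xi>\<^sup>/\<^sup>2\<close> in Hoeffding's bound and is exceeded by none of \<open>\<epsilon>\<^sub>1,\<dots>,\<epsilon>\<^sub>n\<close> with high probability because
  \<open>\<delta>\<xi> > 4\<close> (\<open>noise_correlations_vanish\<close>, \<open>second_moments_converge_uniformly\<close>). A diagonal argument
  (\<open>diagonal_sequence\<close>) turns convergence for each fixed threshold into convergence for the thresholds
  \<open>4\<^sup>-\<^sup>r\<close> with \<open>r = r\<^sub>n \<rightarrow> \<infinity>\<close>, which beats the factor \<open>2\<^sup>m\<close> whenever \<open>m \<le> r\<^sub>n\<close>.
\<close>

section \<open>Linear models with bounded coefficients\<close>

text \<open>
  The functions are collected, not the coefficient vectors: boosting and the scheme
  produce functions, and a bound on some representation of a function is all that is used.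
\<close>

definition l1_ball :: "nat \<Rightarrow> real \<Rightarrow> ((nat \<Rightarrow> real) \<Rightarrow> real) set" where
  "l1_ball p c = {linear_model p b |b. (\<Sum>j\<in>{1..p}. \<bar>b j\<bar>) \<le> c}"

lemma l1_ball_iff:
  "h \<in> l1_ball p c \<longleftrightarrow> (\<exists>b. (\<forall>z. h z = (\<Sum>j\<in>{1..p}. b j * z j)) \<and> (\<Sum>j\<in>{1..p}. \<bar>b j\<bar>) \<le> c)"
  by (auto simp: l1_ball_def linear_model_def fun_eq_iff)

lemma l1_ballI:
  "(\<And>z. h z = (\<Sum>j\<in>{1..p}. b j * z j)) \<Longrightarrow> (\<Sum>j\<in>{1..p}. \<bar>b j\<bar>) \<le> c \<Longrightarrow> h \<in> l1_ball p c"
  unfolding l1_ball_iff by blast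

lemma l1_ball_mono: "c \<le> d \<Longrightarrow> l1_ball p c \<subseteq> l1_ball p d"
  unfolding l1_ball_def by force

lemma l1_ball_radius_nonneg:
  assumes "h \<in> l1_ball p c"
  shows "0 \<le> c"
proof -
  obtain b :: "nat \<Rightarrow> real" where "(\<Sum>j\<in>{1..p}. \<bar>b j\<bar>) \<le> c"
    using assms unfolding l1_ball_iff by blast
  moreover have "0 \<le> (\<Sum>j\<in>{1..p}. \<bar>b j\<bar>)" by (rule sum_nonneg) simp
  ultimately show ?thesis by linarith
qed

lemma zero_in_l1_ball: "0 \<le> c \<Longrightarrow> (\<lambda>z. 0) \<in> l1_ball p c"
  by (rule l1_ballI[where b = "\<lambda>_. 0"]) auto

lemma l1_ball_add:
  assumes "g \<in> l1_ball p c" "h \<in> l1_ball p d"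
  shows "(\<lambda>z. g z + h z) \<in> l1_ball p (c + d)"
proof -
  obtain a where a: "\<And>z. g z = (\<Sum>j\<in>{1..p}. a j * z j)" "(\<Sum>j\<in>{1..p}. \<bar>a j\<bar>) \<le> c"
    using assms(1) unfolding l1_ball_iff by blast
  obtain b where b: "\<And>z. h z = (\<Sum>j\<in>{1..p}. b j * z j)" "(\<Sum>j\<in>{1..p}. \<bar>b j\<bar>) \<le> d"
    using assms(2) unfolding l1_ball_iff by blast
  show ?thesis
  proof (rule l1_ballI[where b = "\<lambda>j. a j + b j"])
    have "(\<Sum>j\<in>{1..p}. \<bar>a j + b j\<bar>) \<le> (\<Sum>j\<in>{1..p}. \<bar>a j\<bar> + \<bar>b j\<bar>)"
      by (intro sum_mono) auto
    then show "(\<Sum>j\<in>{1..p}. \<bar>a j + b j\<bar>) \<le> c + d"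
      using a(2) b(2) by (simp add: sum.distrib)
  qed (simp add: a(1) b(1) sum.distrib algebra_simps)
qed

lemma scaled_baselearner_in_l1_ball:
  assumes "j \<in> {1..p}" "\<bar>t\<bar> \<le> c"
  shows "(\<lambda>z. t * baselearner j z) \<in> l1_ball p c"
  by (rule l1_ballI[where b = "\<lambda>k. if k = j then t else 0"])
    (use assms in \<open>auto simp: baselearner_def if_distrib if_distribR cong: if_cong\<close>)

lemma l1_ball_diff_baselearner:
  assumes "h \<in> l1_ball p c" "j \<in> {1..p}" "\<bar>t\<bar> \<le> d"
  shows "(\<lambda>z. h z - t * baselearner j z) \<in> l1_ball p (c + d)"
  using l1_ball_add[OF assms(1) scaled_baselearner_in_l1_ball[of j p "- t" d]] assms by simp

section \<open>The empirical inner product\<close>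

lemma emp_inner_commute: "emp_inner n u v = emp_inner n v u"
  by (simp add: emp_inner_def mult.commute)

lemma emp_inner_add_left: "emp_inner n (\<lambda>i. u i + u' i) v = emp_inner n u v + emp_inner n u' v"
  by (simp add: emp_inner_def algebra_simps sum.distrib)

lemma emp_inner_diff_left: "emp_inner n (\<lambda>i. u i - u' i) v = emp_inner n u v - emp_inner n u' v"
  by (simp add: emp_inner_def algebra_simps sum_subtractf)

lemma emp_inner_scale_left: "emp_inner n (\<lambda>i. t * u i) v = t * emp_inner n u v"
  by (simp add: emp_inner_def algebra_simps sum_distrib_left)

lemma emp_inner_scale_right: "emp_inner n u (\<lambda>i. t * v i) = t * emp_inner n u v"
  by (simp add: emp_inner_def algebra_simps sum_distrib_left)

lemma emp_inner_diff_right: "emp_inner n u (\<lambda>i. v i - v' i) = emp_inner n u v - emp_inner n u v'"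
  by (simp add: emp_inner_def algebra_simps sum_subtractf)

lemma emp_inner_self_nonneg: "0 \<le> emp_inner n u u"
  by (simp add: emp_inner_def sum_nonneg)

lemma emp_inner_sum_left:
  "emp_inner n (\<lambda>i. \<Sum>j\<in>J. u j i) v = (\<Sum>j\<in>J. emp_inner n (u j) v)"
  unfolding emp_inner_def sum_distrib_right sum_distrib_left by (subst sum.swap) simp

lemma emp_inner_add_self_le:
  "emp_inner n (\<lambda>i. u i + v i) (\<lambda>i. u i + v i) \<le> 2 * emp_inner n u u + 2 * emp_inner n v v"
proof -
  have "emp_inner n (\<lambda>i. u i + v i) (\<lambda>i. u i + v i) + emp_inner n (\<lambda>i. u i - v i) (\<lambda>i. u i - v i)
      = 2 * emp_inner n u u + 2 * emp_inner n v v"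
    by (simp add: emp_inner_def algebra_simps sum.distrib sum_subtractf)
  then show ?thesis using emp_inner_self_nonneg[of n "\<lambda>i. u i - v i"] by linarith
qed

lemma abs_emp_inner_normalized_le_1:
  assumes "emp_inner n u u = 1" "emp_inner n v v = 1"
  shows "\<bar>emp_inner n u v\<bar> \<le> 1"
proof -
  \<comment> \<open>Cauchy-Schwarz for unit vectors needs only the cases \<open>t = 1\<close> and \<open>t = -1\<close>.\<close>
  have "0 \<le> emp_inner n (\<lambda>i. u i - t * v i) (\<lambda>i. u i - t * v i)" for t
    by (rule emp_inner_self_nonneg)
  then have "0 \<le> 1 + t * t - 2 * t * emp_inner n u v" for t
    by (simp add: emp_inner_diff_left emp_inner_diff_right emp_inner_scale_left
        emp_inner_scale_right assms emp_inner_commute[of n v u] algebra_simps)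
  from this[of 1] this[of "-1"] show ?thesis by simp
qed

text \<open>
  Duality of the \<open>\<ell>\<^sup>1\<close>- and the maximum norm: a linear model cannot correlate with \<open>u\<close> better than
  its best baselearner, up to the \<open>\<ell>\<^sup>1\<close>-norm of its coefficients.
\<close>

lemma abs_emp_inner_l1_ball_le:
  assumes h: "h \<in> l1_ball p c"
    and bnd: "\<And>j. j \<in> {1..p} \<Longrightarrow> \<bar>emp_inner n u (\<lambda>i. baselearner j (x i))\<bar> \<le> B" and "0 \<le> B"
  shows "\<bar>emp_inner n (\<lambda>i. h (x i)) u\<bar> \<le> c * B"
proof -
  obtain b where b: "\<And>z. h z = (\<Sum>j\<in>{1..p}. b j * z j)" "(\<Sum>j\<in>{1..p}. \<bar>b j\<bar>) \<le> c"
    using h unfolding l1_ball_iff by blast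
  have "\<bar>emp_inner n (\<lambda>i. h (x i)) u\<bar>
      = \<bar>\<Sum>j\<in>{1..p}. b j * emp_inner n u (\<lambda>i. baselearner j (x i))\<bar>"
    unfolding b(1) emp_inner_sum_left emp_inner_scale_left
    by (simp add: baselearner_def emp_inner_commute[of n u])
  also have "\<dots> \<le> (\<Sum>j\<in>{1..p}. \<bar>b j\<bar> * B)"
    by (rule order_trans[OF sum_abs], rule sum_mono)
      (use bnd in \<open>auto simp: abs_mult intro: mult_left_mono\<close>)
  also have "\<dots> = (\<Sum>j\<in>{1..p}. \<bar>b j\<bar>) * B" by (simp add: sum_distrib_right)
  also have "\<dots> \<le> c * B" using b(2) \<open>0 \<le> B\<close> by (rule mult_right_mono)
  finally show ?thesis .
qed

definition normalized_design :: "nat \<Rightarrow> nat \<Rightarrow> (nat \<Rightarrow> nat \<Rightarrow> real) \<Rightarrow> bool" where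
  "normalized_design n p x \<longleftrightarrow>
     (\<forall>j\<in>{1..p}. emp_inner n (\<lambda>i. baselearner j (x i)) (\<lambda>i. baselearner j (x i)) = 1)"

lemma normalized_design_inner_le:
  assumes x: "normalized_design n p x" and h: "h \<in> l1_ball p c" and j: "j \<in> {1..p}"
  shows "\<bar>emp_inner n (\<lambda>i. h (x i)) (\<lambda>i. baselearner j (x i))\<bar> \<le> c"
proof -
  have "\<bar>emp_inner n (\<lambda>i. h (x i)) (\<lambda>i. baselearner j (x i))\<bar> \<le> c * 1"
  proof (rule abs_emp_inner_l1_ball_le[OF h])
    fix k assume "k \<in> {1..p}"
    then show "\<bar>emp_inner n (\<lambda>i. baselearner j (x i)) (\<lambda>i. baselearner k (x i))\<bar> \<le> 1"
      using x j by (intro abs_emp_inner_normalized_le_1) (auto simp: normalized_design_def)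
  qed simp
  then show ?thesis by simp
qed

lemma normalized_design_norm_le:
  assumes x: "normalized_design n p x" and h: "h \<in> l1_ball p c"
  shows "emp_inner n (\<lambda>i. h (x i)) (\<lambda>i. h (x i)) \<le> c\<^sup>2"
proof -
  have "\<bar>emp_inner n (\<lambda>i. h (x i)) (\<lambda>i. h (x i))\<bar> \<le> c * c"
    by (rule abs_emp_inner_l1_ball_le[OF h normalized_design_inner_le[OF x h]
        l1_ball_radius_nonneg[OF h]])
  then show ?thesis by (simp add: power2_eq_square)
qed

section \<open>Weak greedy approximation\<close>

text \<open>
  Pythagoras: subtracting the projection onto a unit vector lowers the squared norm by the square
  of the coefficient.
\<close>

lemma emp_inner_projection_step:
  assumes "emp_inner n g g = 1"
  shows "emp_inner n (\<lambda>i. u i - emp_inner n u g * g i) (\<lambda>i. u i - emp_inner n u g * g i)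
    = emp_inner n u u - (emp_inner n u g)\<^sup>2"
proof -
  have "emp_inner n (\<lambda>i. u i - c * g i) (\<lambda>i. u i - c * g i)
      = emp_inner n u u - c * emp_inner n u g - (c * emp_inner n u g - c * (c * emp_inner n g g))" for c
    by (simp only: emp_inner_diff_left emp_inner_diff_right emp_inner_scale_left
        emp_inner_scale_right emp_inner_commute[of n g u])
  then show ?thesis by (simp add: power2_eq_square assms)
qed

text \<open>
  Let \<open>e\<^sub>k\<close> be the squared empirical norm of \<open>R\<^sub>k\<close>, \<open>t\<^sub>k\<close> the modulus of the coefficient of step \<open>k\<close> and
  \<open>b\<^sub>k = B + \<Sum>\<^sub>i\<^sub><\<^sub>k t\<^sub>i\<close> a bound for the \<open>\<ell>\<^sup>1\<close>-norm of the coefficients of \<open>R\<^sub>k\<close>. Pythagoras gives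
  \<open>\<Sum> t\<^sub>i\<^sup>2 \<le> e\<^sub>0 \<le> B\<^sup>2\<close>, hence \<open>b\<^sub>k\<^sup>2 \<le> 2(1 + k)B\<^sup>2\<close> by Cauchy-Schwarz. On the other hand duality and
  greediness give \<open>a e\<^sub>k \<le> b\<^sub>k t\<^sub>k\<close>: if \<open>e\<^sub>k\<close> stayed away from zero, then \<open>t\<^sub>k\<^sup>2\<close> would be at least of
  order \<open>1/(1 + k)\<close>, and the harmonic series diverges. This rate is far from optimal, but it suffices
  here because it depends on nothing except \<open>a\<close> and \<open>B\<close>.
\<close>

lemma weak_greedy_bounds:
  fixes R :: "nat \<Rightarrow> (nat \<Rightarrow> real) \<Rightarrow> real"
  assumes x: "normalized_design n p x"
    and R0: "R 0 \<in> l1_ball p B"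
    and s: "\<And>k. s k \<in> {1..p}"
    and step: "\<And>k. R (Suc k) = (\<lambda>z. R k z
        - emp_inner n (\<lambda>i. R k (x i)) (\<lambda>i. baselearner (s k) (x i)) * baselearner (s k) z)"
    and a: "0 < a"
    and greedy: "\<And>k j. j \<in> {1..p} \<Longrightarrow>
        a * \<bar>emp_inner n (\<lambda>i. R k (x i)) (\<lambda>i. baselearner j (x i))\<bar>
        \<le> \<bar>emp_inner n (\<lambda>i. R k (x i)) (\<lambda>i. baselearner (s k) (x i))\<bar>"
  shows "R k \<in> l1_ball p (B * sqrt (2 * (1 + real k)))"
    and "a * emp_inner n (\<lambda>i. R k (x i)) (\<lambda>i. R k (x i)) * sqrt (harm k) \<le> sqrt 2 * B\<^sup>2"
proof -
  define t where "t k = \<bar>emp_inner n (\<lambda>i. R k (x i)) (\<lambda>i. baselearner (s k) (x i))\<bar>" for k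
  define e where "e k = emp_inner n (\<lambda>i. R k (x i)) (\<lambda>i. R k (x i))" for k
  have B: "0 \<le> B" using R0 by (rule l1_ball_radius_nonneg)
  have t0: "0 \<le> t k" for k by (simp add: t_def)
  have e0: "0 \<le> e k" for k by (simp add: e_def emp_inner_self_nonneg)
  have e_step: "e (Suc k) = e k - (t k)\<^sup>2" for k
    unfolding e_def t_def step power2_abs by (rule emp_inner_projection_step)
      (use x s[of k] in \<open>simp add: normalized_design_def\<close>)
  have e_sum: "e k + (\<Sum>i<k. (t i)\<^sup>2) = e 0" for k
    by (induction k) (auto simp: e_step)
  have e_0: "e 0 \<le> B\<^sup>2" unfolding e_def by (rule normalized_design_norm_le[OF x R0])
  have e_decr: "e k \<le> e i" if "i \<le> k" for i k
    using that by (induction rule: dec_induct) (auto simp: e_step intro: order_trans[rotated])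
  define b where "b k = B + (\<Sum>i<k. t i)" for k
  have l1: "R k \<in> l1_ball p (b k)" for k
  proof (induction k)
    case (Suc k)
    have "b (Suc k) = b k + t k" by (simp add: b_def)
    with l1_ball_diff_baselearner[OF Suc s order_refl] show ?case
      unfolding step t_def by simp
  qed (simp add: b_def R0)
  have b_sq: "(b k)\<^sup>2 \<le> 2 * (1 + real k) * B\<^sup>2" for k
  proof -
    \<comment> \<open>\<open>b\<^sub>k\<close> is a sum of \<open>k + 1\<close> terms, the first of which is \<open>B\<close>.\<close>
    define w where "w i = (case i of 0 \<Rightarrow> B | Suc i \<Rightarrow> t i)" for i
    have "b k = (\<Sum>i<Suc k. w i)"
      unfolding b_def sum.lessThan_Suc_shift by (simp add: w_def)
    then have "(b k)\<^sup>2 \<le> (\<Sum>i<Suc k. (w i)\<^sup>2) * (\<Sum>i<Suc k. 1)"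
      using Cauchy_Schwarz_ineq_sum[of w "\<lambda>_. 1" "{..<Suc k}"] by simp
    also have "(\<Sum>i<Suc k. (w i)\<^sup>2) = B\<^sup>2 + (\<Sum>i<k. (t i)\<^sup>2)"
      unfolding sum.lessThan_Suc_shift by (simp add: w_def)
    also have "\<dots> * (\<Sum>i<Suc k. 1) \<le> (B\<^sup>2 + B\<^sup>2) * (\<Sum>i<Suc k. 1)"
      using e_sum[of k] e0[of k] e_0 by (intro mult_right_mono) auto
    finally show ?thesis by (simp add: algebra_simps)
  qed
  have b0: "0 \<le> b k" for k unfolding b_def using B t0 by (simp add: sum_nonneg)
  have "b k \<le> B * sqrt (2 * (1 + real k))"
  proof (rule power2_le_imp_le)
    show "(b k)\<^sup>2 \<le> (B * sqrt (2 * (1 + real k)))\<^sup>2"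
      using b_sq[of k] by (simp add: power_mult_distrib algebra_simps)
  qed (use B in auto)
  then show "R k \<in> l1_ball p (B * sqrt (2 * (1 + real k)))"
    using l1[of k] l1_ball_mono by blast
  have ae: "a * e k \<le> b k * t k" for k
  proof -
    have "\<bar>emp_inner n (\<lambda>i. R k (x i)) (\<lambda>i. R k (x i))\<bar> \<le> b k * (t k / a)"
      by (rule abs_emp_inner_l1_ball_le[OF l1])
        (use greedy[of _ k] a t0 in \<open>auto simp: t_def field_simps\<close>)
    then show ?thesis using a e0[of k] by (simp add: e_def field_simps)
  qed
  \<comment> \<open>Divided by \<open>1 + i\<close>, so that the sum over \<open>i\<close> produces the harmonic number without dividing by \<open>B\<close>.\<close>
  have *: "(a * e k)\<^sup>2 * inverse (real (Suc i)) \<le> 2 * B\<^sup>2 * (t i)\<^sup>2" if "i \<le> k" for i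
  proof -
    have "a * e k \<le> b i * t i" using ae[of i] e_decr[OF that] a
      by (meson mult_left_mono order_trans less_imp_le)
    then have "(a * e k)\<^sup>2 \<le> (b i)\<^sup>2 * (t i)\<^sup>2"
      using a e0 by (metis power_mono power_mult_distrib mult_nonneg_nonneg less_imp_le)
    also have "\<dots> \<le> (2 * (1 + real i) * B\<^sup>2) * (t i)\<^sup>2"
      by (intro mult_right_mono b_sq) auto
    finally show ?thesis by (simp add: field_simps)
  qed
  have "(a * e k)\<^sup>2 * harm k = (\<Sum>i<k. (a * e k)\<^sup>2 * inverse (real (Suc i)))"
    unfolding harm_def sum_distrib_left
    by (rule sum.reindex_bij_witness[of _ Suc "\<lambda>i. i - 1"]) auto
  also have "\<dots> \<le> (\<Sum>i<k. 2 * B\<^sup>2 * (t i)\<^sup>2)" by (intro sum_mono *) auto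
  also have "\<dots> = 2 * B\<^sup>2 * (\<Sum>i<k. (t i)\<^sup>2)" by (simp add: sum_distrib_left)
  also have "\<dots> \<le> 2 * B\<^sup>2 * B\<^sup>2"
    using e_sum[of k] e0[of k] e_0 by (intro mult_left_mono) auto
  finally have "(a * e k * sqrt (harm k))\<^sup>2 \<le> (sqrt 2 * B\<^sup>2)\<^sup>2"
    by (simp add: power_mult_distrib harm_nonneg power4_eq_xxxx power2_eq_square[of B] mult.assoc)
  then show "a * emp_inner n (\<lambda>i. R k (x i)) (\<lambda>i. R k (x i)) * sqrt (harm k) \<le> sqrt 2 * B\<^sup>2"
    unfolding e_def[symmetric] by (rule power2_le_imp_le) auto
qed

section \<open>The error of the boosting model\<close>

text \<open>
  One step maps the difference \<open>E\<close> of the two residual functions to \<open>E - \<langle>E + \<epsilon>, g\<rangle> g\<close>, which adds at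
  most \<open>c + \<zeta>\<close> to an \<open>\<ell>\<^sup>1\<close>-norm \<open>c\<close>. Starting from \<open>0\<close> after the first step, \<open>c \<mapsto> 2c + \<zeta>\<close> yields
  \<open>(2\<^sup>k - 1)\<zeta>\<close> after \<open>k\<close> further steps.
\<close>

lemma boosting_error_minus_scheme:
  assumes x: "normalized_design n p x"
    and s: "\<And>m. m \<ge> 1 \<Longrightarrow> s m \<in> {1..p}"
    and y: "\<And>i. i \<in> {1..n} \<Longrightarrow> y i = f (x i) + e i"
    and noise: "\<And>j. j \<in> {1..p} \<Longrightarrow> \<bar>emp_inner n e (\<lambda>i. baselearner j (x i))\<bar> \<le> \<zeta>"
  shows "(\<lambda>z. f z - boost_model 1 n x y s (Suc k) z - emp_scheme n x y s f (Suc k) z)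
    \<in> l1_ball p ((2 ^ k - 1) * \<zeta>)"
proof (induction k)
  case 0
  show ?case using zero_in_l1_ball[of 0 p] by (simp add: ls_fit_def)
next
  case (Suc k)
  define D where "D z = f z - boost_model 1 n x y s (Suc k) z" for z
  define R where "R = emp_scheme n x y s f (Suc k)"
  define j where "j = s (Suc (Suc k))"
  define g where "g i = baselearner j (x i)" for i
  define d where "d = emp_inner n (\<lambda>i. D (x i) - R (x i)) g + emp_inner n e g"
  have j: "j \<in> {1..p}" using s[of "Suc (Suc k)"] by (simp add: j_def)
  have IH: "(\<lambda>z. D z - R z) \<in> l1_ball p ((2 ^ k - 1) * \<zeta>)"
    using Suc by (simp add: D_def R_def)
  have res: "emp_inner n (\<lambda>i. y i - boost_model 1 n x y s (Suc k) (x i)) g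
      = emp_inner n (\<lambda>i. D (x i)) g + emp_inner n e g"
    unfolding emp_inner_add_left[symmetric] unfolding emp_inner_def
    by (intro arg_cong2[where f = "(*)"] sum.cong) (auto simp: y D_def)
  have D': "f z - boost_model 1 n x y s (Suc (Suc k)) z
      = D z - (emp_inner n (\<lambda>i. D (x i)) g + emp_inner n e g) * baselearner j z" for z
    unfolding boost_model.simps(2)[of 1 n x y s "Suc k"] ls_fit_def j_def[symmetric]
      g_def[symmetric] res by (simp add: D_def)
  have R': "emp_scheme n x y s f (Suc (Suc k)) z
      = R z - emp_inner n (\<lambda>i. R (x i)) g * baselearner j z" for z
    by (simp add: R_def g_def[abs_def] j_def)
  have "\<bar>d\<bar> \<le> (2 ^ k - 1) * \<zeta> + \<zeta>"
    using normalized_design_inner_le[OF x IH j] noise[OF j]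
    unfolding d_def g_def by linarith
  note l1_ball_diff_baselearner[OF IH j this]
  also have "(\<lambda>z. D z - R z - d * baselearner j z) = (\<lambda>z. f z - boost_model 1 n x y s (Suc (Suc k)) z
      - emp_scheme n x y s f (Suc (Suc k)) z)"
    unfolding D' R' d_def emp_inner_diff_left by (auto simp: algebra_simps)
  also have "(2 ^ k - 1) * \<zeta> + ((2 ^ k - 1) * \<zeta> + \<zeta>) = (2 ^ Suc k - 1) * \<zeta>"
    by (simp add: algebra_simps)
  finally show ?case .
qed

text \<open>
  The error is the residual function of the scheme plus the small difference bounded above. The
  greedy algorithm is started at the residual after the first step, which projects the
  responses: its coefficients have \<open>\<ell>\<^sup>1\<close>-norm at most \<open>B + |\<langle>Y,g\<rangle>| \<le> 2B + \<zeta>\<close>. Therefore the corr-min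
  condition enters only from the second iteration on.
\<close>

lemma boosting_error_bounds:
  fixes k :: nat
  assumes x: "normalized_design n p x"
    and s: "\<And>m. m \<ge> 1 \<Longrightarrow> s m \<in> {1..p}"
    and f: "f \<in> l1_ball p B"
    and y: "\<And>i. i \<in> {1..n} \<Longrightarrow> y i = f (x i) + e i"
    and noise: "\<And>j. j \<in> {1..p} \<Longrightarrow> \<bar>emp_inner n e (\<lambda>i. baselearner j (x i))\<bar> \<le> \<zeta>"
    and a: "0 < a"
    and corr_min: "\<And>m j. m \<ge> 2 \<Longrightarrow> j \<in> {1..p} \<Longrightarrow>
        a * \<bar>emp_inner n (\<lambda>i. emp_scheme n x y s f (m - 1) (x i)) (\<lambda>i. baselearner j (x i))\<bar>
        \<le> \<bar>emp_inner n (\<lambda>i. emp_scheme n x y s f (m - 1) (x i)) (\<lambda>i. baselearner (s m) (x i))\<bar>"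
  defines "D \<equiv> \<lambda>z. f z - boost_model 1 n x y s (Suc k) z"
  shows "D \<in> l1_ball p ((2 * B + \<zeta>) * sqrt (2 * (1 + real k)) + (2 ^ k - 1) * \<zeta>)" (is "_ \<in> l1_ball p ?r")
    and "k \<ge> 1 \<Longrightarrow> emp_inner n (\<lambda>i. D (x i)) (\<lambda>i. D (x i))
      \<le> 2 * (sqrt 2 * (2 * B + \<zeta>)\<^sup>2 / (a * sqrt (harm k))) + 2 * ((2 ^ k - 1) * \<zeta>)\<^sup>2"
proof -
  define R where "R k = emp_scheme n x y s f (Suc k)" for k
  have s1: "s 1 \<in> {1..p}" by (rule s) simp
  have "emp_inner n y (\<lambda>i. baselearner (s 1) (x i))
      = emp_inner n (\<lambda>i. f (x i)) (\<lambda>i. baselearner (s 1) (x i))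
        + emp_inner n e (\<lambda>i. baselearner (s 1) (x i))"
    unfolding emp_inner_add_left[symmetric] unfolding emp_inner_def
    by (intro arg_cong2[where f = "(*)"] sum.cong) (auto simp: y)
  then have "\<bar>emp_inner n y (\<lambda>i. baselearner (s 1) (x i))\<bar> \<le> B + \<zeta>"
    using normalized_design_inner_le[OF x f s1] noise[OF s1] by linarith
  from l1_ball_diff_baselearner[OF f s1 this]
  have R0: "R 0 \<in> l1_ball p (2 * B + \<zeta>)" by (simp add: R_def add_ac)
  have step: "R (Suc k) = (\<lambda>z. R k z
      - emp_inner n (\<lambda>i. R k (x i)) (\<lambda>i. baselearner (s (Suc (Suc k))) (x i))
        * baselearner (s (Suc (Suc k))) z)" for k
    by (simp add: R_def)
  have greedy: "a * \<bar>emp_inner n (\<lambda>i. R k (x i)) (\<lambda>i. baselearner j (x i))\<bar>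
      \<le> \<bar>emp_inner n (\<lambda>i. R k (x i)) (\<lambda>i. baselearner (s (Suc (Suc k))) (x i))\<bar>"
    if "j \<in> {1..p}" for k j
    using corr_min[of "Suc (Suc k)" j] that by (simp add: R_def)
  have s': "s (Suc (Suc k)) \<in> {1..p}" for k by (rule s) simp
  note wg = weak_greedy_bounds[where R = R and s = "\<lambda>k. s (Suc (Suc k))", OF x R0 s' step a greedy]
  define E where "E z = D z - R k z" for z
  have E: "E \<in> l1_ball p ((2 ^ k - 1) * \<zeta>)"
    unfolding E_def D_def R_def
    by (rule boosting_error_minus_scheme[where e = e, OF x s y noise])
  have D: "D = (\<lambda>z. R k z + E z)" by (auto simp: E_def)
  show "D \<in> l1_ball p ?r" unfolding D by (rule l1_ball_add[OF wg(1) E])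
  assume "k \<ge> 1"
  then have h: "0 < sqrt (harm k :: real)" by (simp add: harm_pos)
  have "emp_inner n (\<lambda>i. D (x i)) (\<lambda>i. D (x i)) \<le> 2 * emp_inner n (\<lambda>i. R k (x i)) (\<lambda>i. R k (x i))
      + 2 * emp_inner n (\<lambda>i. E (x i)) (\<lambda>i. E (x i))"
    unfolding D by (rule emp_inner_add_self_le)
  also have "emp_inner n (\<lambda>i. R k (x i)) (\<lambda>i. R k (x i)) \<le> sqrt 2 * (2 * B + \<zeta>)\<^sup>2 / (a * sqrt (harm k))"
    using wg(2)[of k] a h by (simp add: field_simps)
  also have "emp_inner n (\<lambda>i. E (x i)) (\<lambda>i. E (x i)) \<le> ((2 ^ k - 1) * \<zeta>)\<^sup>2"
    by (rule normalized_design_norm_le[OF x E])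
  finally show "emp_inner n (\<lambda>i. D (x i)) (\<lambda>i. D (x i))
      \<le> 2 * (sqrt 2 * (2 * B + \<zeta>)\<^sup>2 / (a * sqrt (harm k))) + 2 * ((2 ^ k - 1) * \<zeta>)\<^sup>2" by simp
qed

lemma integral_linear_square:
  fixes b :: "nat \<Rightarrow> real"
  assumes int: "\<And>j k. j \<in> {1..p} \<Longrightarrow> k \<in> {1..p} \<Longrightarrow> integrable M (\<lambda>z. z j * z k :: real)"
  shows "(\<integral>z. \<bar>\<Sum>j\<in>{1..p}. b j * z j\<bar>\<^sup>2 \<partial>M)
    = (\<Sum>j\<in>{1..p}. \<Sum>k\<in>{1..p}. b j * b k * (\<integral>z. z j * z k \<partial>M))"
proof -
  have "\<bar>\<Sum>j\<in>{1..p}. b j * z j\<bar>\<^sup>2 = (\<Sum>j\<in>{1..p}. \<Sum>k\<in>{1..p}. b j * b k * (z j * z k))" for z :: "nat \<Rightarrow> real"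
    unfolding power2_abs unfolding power2_eq_square sum_product
    by (intro sum.cong refl) (simp add: ac_simps)
  then have "(\<integral>z. \<bar>\<Sum>j\<in>{1..p}. b j * z j\<bar>\<^sup>2 \<partial>M)
      = (\<integral>z. (\<Sum>j\<in>{1..p}. \<Sum>k\<in>{1..p}. b j * b k * (z j * z k)) \<partial>M)"
    by simp
  also have "\<dots> = (\<Sum>j\<in>{1..p}. \<integral>z. (\<Sum>k\<in>{1..p}. b j * b k * (z j * z k)) \<partial>M)"
    by (intro Bochner_Integration.integral_sum Bochner_Integration.integrable_sum
        integrable_mult_right int)
  also have "\<dots> = (\<Sum>j\<in>{1..p}. \<Sum>k\<in>{1..p}. b j * b k * (\<integral>z. z j * z k \<partial>M))"
    unfolding integral_mult_right_zero[symmetric]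
    by (intro sum.cong refl Bochner_Integration.integral_sum integrable_mult_right int)
  finally show ?thesis .
qed

text \<open>
  Both sides are quadratic forms in the same coefficients, and the entries of their matrices
  differ by at most \<open>\<tau>\<close>.
\<close>

lemma l1_ball_moment_deviation:
  assumes h: "h \<in> l1_ball p c"
    and int: "\<And>j k. j \<in> {1..p} \<Longrightarrow> k \<in> {1..p} \<Longrightarrow> integrable M (\<lambda>z. z j * z k)"
    and dev: "\<And>j k. j \<in> {1..p} \<Longrightarrow> k \<in> {1..p} \<Longrightarrow>
      \<bar>emp_inner n (\<lambda>i. x i j) (\<lambda>i. x i k) - (\<integral>z. z j * z k \<partial>M)\<bar> \<le> \<tau>"
    and "0 \<le> \<tau>"
  shows "(\<integral>z. \<bar>h z\<bar>\<^sup>2 \<partial>M) \<le> emp_inner n (\<lambda>i. h (x i)) (\<lambda>i. h (x i)) + c\<^sup>2 * \<tau>"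
proof -
  obtain b where b: "\<And>z. h z = (\<Sum>j\<in>{1..p}. b j * z j)" "(\<Sum>j\<in>{1..p}. \<bar>b j\<bar>) \<le> c"
    using h unfolding l1_ball_iff by blast
  define I where "I j k = (\<integral>z. z j * z k \<partial>M)" for j k
  define e where "e j k = emp_inner n (\<lambda>i. x i j) (\<lambda>i. x i k)" for j k
  have 1: "(\<integral>z. \<bar>h z\<bar>\<^sup>2 \<partial>M) = (\<Sum>j\<in>{1..p}. \<Sum>k\<in>{1..p}. b j * b k * I j k)"
    unfolding b(1) I_def by (rule integral_linear_square[OF int])
  have h_inner: "emp_inner n (\<lambda>i. h (x i)) u = (\<Sum>k\<in>{1..p}. b k * emp_inner n (\<lambda>i. x i k) u)" for u
    unfolding b(1) emp_inner_sum_left emp_inner_scale_left ..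
  have 2: "emp_inner n (\<lambda>i. h (x i)) (\<lambda>i. h (x i)) = (\<Sum>j\<in>{1..p}. \<Sum>k\<in>{1..p}. b j * b k * e j k)"
    unfolding h_inner emp_inner_commute[of n _ "\<lambda>i. h (x i)"] e_def
    by (simp add: sum_distrib_left emp_inner_commute mult.assoc)
  have "(\<integral>z. \<bar>h z\<bar>\<^sup>2 \<partial>M) - emp_inner n (\<lambda>i. h (x i)) (\<lambda>i. h (x i))
      = (\<Sum>j\<in>{1..p}. \<Sum>k\<in>{1..p}. b j * b k * (I j k - e j k))"
    unfolding 1 2 by (simp add: sum_subtractf algebra_simps)
  also have "\<dots> \<le> (\<Sum>j\<in>{1..p}. \<Sum>k\<in>{1..p}. \<bar>b j\<bar> * \<bar>b k\<bar> * \<tau>)"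
  proof (intro sum_mono)
    fix j k assume "j \<in> {1..p}" "k \<in> {1..p}"
    then have "\<bar>b j * b k * (I j k - e j k)\<bar> \<le> \<bar>b j\<bar> * \<bar>b k\<bar> * \<tau>"
      unfolding abs_mult using dev[of j k] unfolding I_def e_def
      by (intro mult_left_mono) auto
    then show "b j * b k * (I j k - e j k) \<le> \<bar>b j\<bar> * \<bar>b k\<bar> * \<tau>" by linarith
  qed
  also have "\<dots> = (\<Sum>j\<in>{1..p}. \<bar>b j\<bar>)\<^sup>2 * \<tau>"
    by (subst power2_eq_square, subst sum_product, simp only: sum_distrib_right)
  also have "\<dots> \<le> c\<^sup>2 * \<tau>"
    using b(2) \<open>0 \<le> \<tau>\<close> by (intro mult_right_mono power_mono) (auto simp: sum_nonneg)
  finally show ?thesis by simp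
qed

section \<open>Independence of noise and design\<close>

lemma indep_rv_prob_Int:
  assumes "prob_space P" "indep_rv P A U B V" "E \<in> sets A" "F \<in> sets B"
  shows "measure P ((U -` E \<inter> space P) \<inter> (V -` F \<inter> space P))
    = measure P (U -` E \<inter> space P) * measure P (V -` F \<inter> space P)"
proof -
  interpret prob_space P by fact
  show ?thesis
    using assms(2-4) unfolding indep_rv_def indep_sets2_eq
    by (blast intro: in_vimage_algebra)
qed

lemma indep_rv_imp_indep_var_compose:
  assumes P: "prob_space P" and UV: "indep_rv P A U B V"
    and h: "h \<in> measurable A S" and k: "k \<in> measurable B T"
  shows "prob_space.indep_var P S (\<lambda>\<omega>. h (U \<omega>)) T (\<lambda>\<omega>. k (V \<omega>))"
proof -
  interpret prob_space P by fact
  have U: "U \<in> measurable P A" and V: "V \<in> measurable P B"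
    using UV by (auto simp: indep_rv_def)
  show ?thesis
    unfolding indep_var_eq
  proof (intro conjI indep_set_sigma_sets)
    show "random_variable S (\<lambda>\<omega>. h (U \<omega>))" "random_variable T (\<lambda>\<omega>. k (V \<omega>))"
      using U V h k by (auto intro: measurable_compose)
    show "Int_stable {(\<lambda>\<omega>. h (U \<omega>)) -` E \<inter> space P |E. E \<in> sets S}"
      "Int_stable {(\<lambda>\<omega>. k (V \<omega>)) -` E \<inter> space P |E. E \<in> sets T}"
      by (auto simp: Int_stable_def) (metis Int_assoc Int_left_commute sets.Int vimage_Int inf.idem)+
    have hE: "(\<lambda>\<omega>. h (U \<omega>)) -` E \<inter> space P = U -` (h -` E \<inter> space A) \<inter> space P" for E
      using measurable_space[OF U] by auto
    have kE: "(\<lambda>\<omega>. k (V \<omega>)) -` E \<inter> space P = V -` (k -` E \<inter> space B) \<inter> space P" for E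
      using measurable_space[OF V] by auto
    show "indep_set {(\<lambda>\<omega>. h (U \<omega>)) -` E \<inter> space P |E. E \<in> sets S}
        {(\<lambda>\<omega>. k (V \<omega>)) -` E \<inter> space P |E. E \<in> sets T}"
      unfolding indep_sets2_eq hE kE
      using indep_rv_prob_Int[OF P UV] measurable_sets[OF h] measurable_sets[OF k]
        measurable_sets[OF U] measurable_sets[OF V]
      by (auto simp del: vimage_Int)
  qed
qed

text \<open>
  Two independent families that are jointly independent of each other form an
  independent family of pairs. The rectangles \<open>{U\<^sub>i \<in> A, V\<^sub>i \<in> B}\<close> factorize, first
  between the families and then within each of them; they are stable under intersection and
  generate the events of the pair.
\<close>

lemma indep_vars_Pair:
  assumes P: "prob_space P" and I: "finite I"
    and U: "prob_space.indep_vars P S U I" and V: "prob_space.indep_vars P T V I"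
    and UV: "indep_rv P (Pi\<^sub>M I S) (\<lambda>\<omega>. \<lambda>i\<in>I. U i \<omega>) (Pi\<^sub>M I T) (\<lambda>\<omega>. \<lambda>i\<in>I. V i \<omega>)"
  shows "prob_space.indep_vars P (\<lambda>i. S i \<Otimes>\<^sub>M T i) (\<lambda>i \<omega>. (U i \<omega>, V i \<omega>)) I"
proof -
  interpret prob_space P by fact
  have Um: "U i \<in> measurable P (S i)" and Vm: "V i \<in> measurable P (T i)" if "i \<in> I" for i
    using U V that by (auto simp: indep_vars_def2)
  define G where "G i = {(U i -` A \<inter> space P) \<inter> (V i -` B \<inter> space P) |A B.
    A \<in> sets (S i) \<and> B \<in> sets (T i)}" for i
  have "indep_sets G I"
  proof (rule indep_setsI)
    fix i assume "i \<in> I"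
    then show "G i \<subseteq> events"
      using measurable_sets[OF Um] measurable_sets[OF Vm] by (auto simp: G_def)
  next
    fix E J assume J: "J \<noteq> {}" "J \<subseteq> I" "finite J" and "\<forall>j\<in>J. E j \<in> G j"
    then have "\<forall>j\<in>J. \<exists>A B. E j = (U j -` A \<inter> space P) \<inter> (V j -` B \<inter> space P)
        \<and> A \<in> sets (S j) \<and> B \<in> sets (T j)"
      unfolding G_def by auto
    then obtain A B where E: "\<And>j. j \<in> J \<Longrightarrow> E j = (U j -` A j \<inter> space P) \<inter> (V j -` B j \<inter> space P)"
      and A: "\<And>j. j \<in> J \<Longrightarrow> A j \<in> sets (S j)" and B: "\<And>j. j \<in> J \<Longrightarrow> B j \<in> sets (T j)"
      by metis
    \<comment> \<open>The events about the \<open>U\<^sub>j\<close> with \<open>j \<in> J\<close> as one event about the whole family, to which the joint independence applies.\<close>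
    define A' where "A' = {u \<in> space (Pi\<^sub>M I S). \<forall>j\<in>J. u j \<in> A j}"
    define B' where "B' = {v \<in> space (Pi\<^sub>M I T). \<forall>j\<in>J. v j \<in> B j}"
    have A': "A' \<in> sets (Pi\<^sub>M I S)" and B': "B' \<in> sets (Pi\<^sub>M I T)"
      unfolding A'_def B'_def using J A B
      by (auto intro!: sets.sets_Collect_finite_All'
          intro: measurable_sets_Collect[OF measurable_component_singleton, where P = "\<lambda>x. x \<in> _"])
    have UA: "(\<lambda>\<omega>. \<lambda>i\<in>I. U i \<omega>) -` A' \<inter> space P = (\<Inter>j\<in>J. U j -` A j \<inter> space P)"
      using J(1,2) measurable_space[OF Um] by (auto simp: A'_def space_PiM)
    have VB: "(\<lambda>\<omega>. \<lambda>i\<in>I. V i \<omega>) -` B' \<inter> space P = (\<Inter>j\<in>J. V j -` B j \<inter> space P)"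
      using J(1,2) measurable_space[OF Vm] by (auto simp: B'_def space_PiM)
    have "(\<Inter>j\<in>J. E j) = (\<Inter>j\<in>J. U j -` A j \<inter> space P) \<inter> (\<Inter>j\<in>J. V j -` B j \<inter> space P)"
      using E by auto
    then have "prob (\<Inter>j\<in>J. E j)
        = prob (\<Inter>j\<in>J. U j -` A j \<inter> space P) * prob (\<Inter>j\<in>J. V j -` B j \<inter> space P)"
      using indep_rv_prob_Int[OF P UV A' B'] UA VB by simp
    also have "prob (\<Inter>j\<in>J. U j -` A j \<inter> space P) = (\<Prod>j\<in>J. prob (U j -` A j \<inter> space P))"
      using J A by (intro indep_varsD[OF U]) auto
    also have "prob (\<Inter>j\<in>J. V j -` B j \<inter> space P) = (\<Prod>j\<in>J. prob (V j -` B j \<inter> space P))"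
      using J B by (intro indep_varsD[OF V]) auto
    also have "(\<Prod>j\<in>J. prob (U j -` A j \<inter> space P)) * (\<Prod>j\<in>J. prob (V j -` B j \<inter> space P))
        = (\<Prod>j\<in>J. prob (E j))"
    proof (unfold prod.distrib[symmetric], rule prod.cong[OF refl])
      fix j assume j: "j \<in> J"
      define A1 where "A1 = {u \<in> space (Pi\<^sub>M I S). u j \<in> A j}"
      define B1 where "B1 = {v \<in> space (Pi\<^sub>M I T). v j \<in> B j}"
      have 1: "A1 \<in> sets (Pi\<^sub>M I S)" "B1 \<in> sets (Pi\<^sub>M I T)"
        unfolding A1_def B1_def using j J A[OF j] B[OF j]
        by (auto intro: measurable_sets_Collect[OF measurable_component_singleton, where P = "\<lambda>x. x \<in> _"])
      have 2: "(\<lambda>\<omega>. \<lambda>i\<in>I. U i \<omega>) -` A1 \<inter> space P = U j -` A j \<inter> space P"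
        "(\<lambda>\<omega>. \<lambda>i\<in>I. V i \<omega>) -` B1 \<inter> space P = V j -` B j \<inter> space P"
        using J(2) j measurable_space[OF Um] measurable_space[OF Vm]
        by (auto simp: A1_def B1_def space_PiM)
      show "prob (U j -` A j \<inter> space P) * prob (V j -` B j \<inter> space P) = prob (E j)"
        using indep_rv_prob_Int[OF P UV 1] unfolding 2 E[OF j] by simp
    qed
    finally show "prob (\<Inter>j\<in>J. E j) = (\<Prod>j\<in>J. prob (E j))" .
  qed
  moreover have "Int_stable (G i)" for i
  proof (rule Int_stableI)
    fix E F assume "E \<in> G i" "F \<in> G i"
    then obtain A B A' B' where "E = (U i -` A \<inter> space P) \<inter> (V i -` B \<inter> space P)"
      "F = (U i -` A' \<inter> space P) \<inter> (V i -` B' \<inter> space P)"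
      and s: "A \<in> sets (S i)" "A' \<in> sets (S i)" "B \<in> sets (T i)" "B' \<in> sets (T i)"
      unfolding G_def by auto
    then have "E \<inter> F = (U i -` (A \<inter> A') \<inter> space P) \<inter> (V i -` (B \<inter> B') \<inter> space P)" by auto
    with s show "E \<inter> F \<in> G i" unfolding G_def by blast
  qed
  ultimately have ind: "indep_sets (\<lambda>i. sigma_sets (space P) (G i)) I"
    by (rule indep_sets_sigma)
  show ?thesis
    unfolding indep_vars_def2
  proof (intro conjI ballI)
    show "(\<lambda>\<omega>. (U i \<omega>, V i \<omega>)) \<in> measurable P (S i \<Otimes>\<^sub>M T i)" if "i \<in> I" for i
      using Um[OF that] Vm[OF that] by (rule measurable_Pair)
    show "indep_sets (\<lambda>i. {(\<lambda>\<omega>. (U i \<omega>, V i \<omega>)) -` A \<inter> space P |A. A \<in> sets (S i \<Otimes>\<^sub>M T i)}) I"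
    proof (rule indep_sets_mono_sets[OF ind])
      fix i assume i: "i \<in> I"
      \<comment> \<open>The pair is measurable already with respect to the sigma-algebra generated by the rectangles.\<close>
      define N where "N = sigma (space P) (G i)"
      have GP: "G i \<subseteq> Pow (space P)" by (auto simp: G_def)
      have "U i \<in> measurable N (S i)"
      proof (rule measurableI)
        fix A assume A: "A \<in> sets (S i)"
        have "U i -` A \<inter> space P \<in> G i"
          unfolding G_def using A i measurable_space[OF Vm]
          by (intro CollectI exI[of _ A] exI[of _ "space (T i)"]) auto
        then show "U i -` A \<inter> space N \<in> sets N" using GP by (auto simp: N_def)
      qed (use i measurable_space[OF Um] GP in \<open>auto simp: N_def\<close>)
      moreover have "V i \<in> measurable N (T i)"
      proof (rule measurableI)
        fix B assume B: "B \<in> sets (T i)"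
        have "V i -` B \<inter> space P \<in> G i"
          unfolding G_def using B i measurable_space[OF Um]
          by (intro CollectI exI[of _ "space (S i)"] exI[of _ B]) auto
        then show "V i -` B \<inter> space N \<in> sets N" using GP by (auto simp: N_def)
      qed (use i measurable_space[OF Vm] GP in \<open>auto simp: N_def\<close>)
      ultimately have "(\<lambda>\<omega>. (U i \<omega>, V i \<omega>)) \<in> measurable N (S i \<Otimes>\<^sub>M T i)"
        by (rule measurable_Pair)
      from measurable_sets[OF this]
      show "{(\<lambda>\<omega>. (U i \<omega>, V i \<omega>)) -` A \<inter> space P |A. A \<in> sets (S i \<Otimes>\<^sub>M T i)}
          \<subseteq> sigma_sets (space P) (G i)"
        using GP by (auto simp: N_def)
    qed
  qed
qed

section \<open>Concentration and union bounds\<close>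

lemma Hoeffding_average:
  assumes P: "prob_space P" and n: "n \<ge> 1"
    and W: "prob_space.indep_vars P (\<lambda>_. borel) W {1..n}"
    and bnd: "\<And>i. i \<in> {1..n} \<Longrightarrow> AE \<omega> in P. \<bar>W i \<omega>\<bar> \<le> b" and b: "0 < b"
    and mean: "\<And>i. i \<in> {1..n} \<Longrightarrow> prob_space.expectation P (W i) = \<mu>"
    and \<tau>: "0 \<le> \<tau>"
  shows "measure P {\<omega> \<in> space P. \<bar>1 / real n * (\<Sum>i\<in>{1..n}. W i \<omega>) - \<mu>\<bar> \<ge> \<tau>}
    \<le> 2 * exp (- (real n * \<tau>\<^sup>2 / (2 * b\<^sup>2)))"
proof -
  interpret prob_space P by fact
  interpret H: Hoeffding_ineq P "{1..n}" W "\<lambda>_. -b" "\<lambda>_. b" "\<Sum>i\<in>{1..n}. expectation (W i)"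
  proof unfold_locales
    fix i assume "i \<in> {1..n}"
    from bnd[OF this] show "AE \<omega> in P. W i \<omega> \<in> {-b..b}" by eventually_elim auto
  qed (use W in auto)
  have "\<bar>1 / real n * s - \<mu>\<bar> \<ge> \<tau> \<longleftrightarrow> \<bar>s - real n * \<mu>\<bar> \<ge> real n * \<tau>" for s
  proof -
    have "\<bar>s - real n * \<mu>\<bar> = real n * \<bar>1 / real n * s - \<mu>\<bar>"
      using n by (simp add: abs_mult_pos' field_simps)
    then show ?thesis using n by simp
  qed
  moreover have "prob {\<omega> \<in> space P. \<bar>(\<Sum>i\<in>{1..n}. W i \<omega>) - (\<Sum>i\<in>{1..n}. expectation (W i))\<bar> \<ge> real n * \<tau>}
      \<le> 2 * exp (-2 * (real n * \<tau>)\<^sup>2 / (\<Sum>i\<in>{1..n}. (b - (-b))\<^sup>2))"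
    by (rule H.Hoeffding_ineq_abs_ge) (use \<tau> n b in auto)
  moreover have "-2 * (real n * \<tau>)\<^sup>2 / (\<Sum>i\<in>{1..n}. (b - (-b))\<^sup>2) = - (real n * \<tau>\<^sup>2 / (2 * b\<^sup>2))"
    using n b by (simp add: power2_eq_square field_simps)
  ultimately show ?thesis by (simp add: mean)
qed

text \<open>
  The factor \<open>p\<^sup>2\<close> is at most of order \<open>exp(2C n\<^sup>1\<^sup>-\<^sup>\<xi>)\<close>, and \<open>1 - \<xi> < 1 - \<theta>\<close>. For the second moments
  it is used with \<open>\<theta> = 0\<close>, for the truncated noise with \<open>\<theta> = \<xi>/2\<close>.
\<close>

lemma subexponential_dimension_union_bound:
  fixes p :: "nat \<Rightarrow> nat"
  assumes p: "(\<lambda>n. real (p n)) \<in> O(\<lambda>n. exp (C * real n powr (1 - \<xi>)))"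
    and \<theta>: "\<theta> < \<xi>" "\<xi> < 1" and c: "0 < c"
  shows "(\<lambda>n. (real (p n))\<^sup>2 * exp (- (c * real n powr (1 - \<theta>)))) \<longlonglongrightarrow> 0"
proof -
  have "(\<lambda>n. (real (p n))\<^sup>2 * exp (- (c * real n powr (1 - \<theta>))))
      \<in> O(\<lambda>n. (exp (C * real n powr (1 - \<xi>)))\<^sup>2 * exp (- (c * real n powr (1 - \<theta>))))"
    by (intro landau_o.big.mult landau_o.big_power p) auto
  moreover have "(\<lambda>n. (exp (C * real n powr (1 - \<xi>)))\<^sup>2 * exp (- (c * real n powr (1 - \<theta>)))) \<longlonglongrightarrow> 0"
  proof -
    have "filterlim (\<lambda>n. (2 * C * real n powr (\<theta> - \<xi>) - c) * real n powr (1 - \<theta>)) at_bot sequentially"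
    proof (rule filterlim_tendsto_neg_mult_at_bot)
      show "(\<lambda>n. 2 * C * real n powr (\<theta> - \<xi>) - c) \<longlonglongrightarrow> 2 * C * 0 - c"
        using \<theta> by (intro tendsto_intros tendsto_neg_powr filterlim_real_sequentially) auto
      show "filterlim (\<lambda>n. real n powr (1 - \<theta>)) at_top sequentially"
        using \<theta> by real_asymp
    qed (use c in simp)
    then have "(\<lambda>n. exp ((2 * C * real n powr (\<theta> - \<xi>) - c) * real n powr (1 - \<theta>))) \<longlonglongrightarrow> 0"
      by (rule filterlim_compose[OF exp_at_bot])
    moreover have "exp ((2 * C * real n powr (\<theta> - \<xi>) - c) * real n powr (1 - \<theta>))
        = (exp (C * real n powr (1 - \<xi>)))\<^sup>2 * exp (- (c * real n powr (1 - \<theta>)))" for n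
    proof -
      have "real n powr (\<theta> - \<xi>) * real n powr (1 - \<theta>) = real n powr (1 - \<xi>)"
        by (simp flip: powr_add)
      then show ?thesis
        by (simp add: power2_eq_square algebra_simps flip: exp_add)
    qed
    ultimately show ?thesis by simp
  qed
  ultimately have "(\<lambda>n. (real (p n))\<^sup>2 * exp (- (c * real n powr (1 - \<theta>)))) \<in> o(\<lambda>_. 1)"
    by (intro landau_o.big_small_trans[OF _ smalloI_tendsto]) auto
  from smalloD_tendsto[OF this] show ?thesis by simp
qed

text \<open>
  "Sufficiently slowly": what holds eventually for each fixed \<open>k\<close> holds eventually along some
  \<open>k = r\<^sub>n \<rightarrow> \<infinity>\<close>.
\<close>

lemma diagonal_sequence:
  assumes "\<And>k :: nat. \<forall>\<^sub>F n in sequentially. Q k n"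
  obtains r :: "nat \<Rightarrow> nat" where "filterlim r at_top sequentially" "\<forall>\<^sub>F n in sequentially. Q (r n) n"
proof -
  from assms have "\<forall>k. \<exists>N. \<forall>n\<ge>N. Q k n" by (auto simp: eventually_sequentially)
  then obtain N where N: "\<And>k n. n \<ge> N k \<Longrightarrow> Q k n" by metis
  \<comment> \<open>The bound \<open>k \<le> n\<close> only keeps the set finite.\<close>
  define S where "S n = {k. k \<le> n \<and> N k \<le> n}" for n
  define r where "r n = (if S n = {} then 0 else Max (S n))" for n
  have fin: "finite (S n)" for n by (simp add: S_def)
  have ge: "k \<le> r n" if "k \<in> S n" for k n
    using that fin by (auto simp: r_def)
  have "filterlim r at_top sequentially"
    unfolding filterlim_at_top
  proof
    fix k
    show "\<forall>\<^sub>F n in sequentially. k \<le> r n"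
      using eventually_ge_at_top[of "max k (N k)"] by eventually_elim (auto intro!: ge simp: S_def)
  qed
  moreover have "\<forall>\<^sub>F n in sequentially. Q (r n) n"
    using eventually_ge_at_top[of "N 0"]
  proof eventually_elim
    case (elim n)
    then have "S n \<noteq> {}" by (auto simp: S_def)
    then have "r n \<in> S n" using Max_in[OF fin] by (simp add: r_def)
    then show ?case by (auto simp: S_def intro: N)
  qed
  ultimately show ?thesis by (rule that)
qed

lemma AE_identical_distr:
  assumes "distr P A U = distr P A V" "U \<in> measurable P A" "V \<in> measurable P A"
    and "{z \<in> space A. Q z} \<in> sets A" "AE \<omega> in P. Q (V \<omega>)"
  shows "AE \<omega> in P. Q (U \<omega>)"
  using AE_distr_iff[OF assms(2,4)] AE_distr_iff[OF assms(3,4)] assms(5) unfolding assms(1) by blast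

lemma expectation_identical_distr:
  fixes h :: "'b \<Rightarrow> real"
  assumes "distr P A U = distr P A V" "U \<in> measurable P A" "V \<in> measurable P A"
    and "h \<in> borel_measurable A"
  shows "(\<integral>\<omega>. h (U \<omega>) \<partial>P) = (\<integral>\<omega>. h (V \<omega>) \<partial>P)"
  using integral_distr[OF assms(2,4)] integral_distr[OF assms(3,4)] assms(1) by simp

lemma covar_component_measurable:
  "j \<in> {1..p} \<Longrightarrow> (\<lambda>z. z j) \<in> borel_measurable (covar_space p)"
  by (rule measurable_component_singleton)

text \<open>
  Hoeffding's inequality for the products \<open>X\<^sub>i\<^sub>,\<^sub>j X\<^sub>i\<^sub>,\<^sub>k\<close>, which are bounded by \<open>K\<^sup>2\<close>, and a union
  bound over the \<open>p\<^sup>2\<close> pairs.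
\<close>

lemma empirical_second_moment_tail:
  fixes X :: "nat \<Rightarrow> 'a \<Rightarrow> nat \<Rightarrow> real"
  assumes P: "prob_space P" and n: "n \<ge> 1"
    and X: "prob_space.indep_vars P (\<lambda>_. covar_space p) X {1..n}"
    and ident: "\<And>i. i \<in> {1..n} \<Longrightarrow> distr P (covar_space p) (X i) = distr P (covar_space p) (X 1)"
    and bnd: "\<And>j. j \<in> {1..p} \<Longrightarrow> AE \<omega> in P. \<bar>X 1 \<omega> j\<bar> \<le> K" and K: "0 < K" and \<tau>: "0 \<le> \<tau>"
  shows "measure P {\<omega> \<in> space P. \<exists>j\<in>{1..p}. \<exists>k\<in>{1..p}.
      \<bar>emp_inner n (\<lambda>i. X i \<omega> j) (\<lambda>i. X i \<omega> k) - (\<integral>z. z j * z k \<partial>distr P (covar_space p) (X 1))\<bar> \<ge> \<tau>}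
    \<le> (real p)\<^sup>2 * (2 * exp (- (real n * \<tau>\<^sup>2 / (2 * (K\<^sup>2)\<^sup>2))))"
proof -
  interpret prob_space P by fact
  have Xm: "X i \<in> measurable P (covar_space p)" if "i \<in> {1..n}" for i
    using X that by (auto simp: indep_vars_def2)
  note X1 = Xm[of 1]
  define B where "B j k = {\<omega> \<in> space P. \<bar>emp_inner n (\<lambda>i. X i \<omega> j) (\<lambda>i. X i \<omega> k)
      - (\<integral>z. z j * z k \<partial>distr P (covar_space p) (X 1))\<bar> \<ge> \<tau>}" for j k
  have Xj: "(\<lambda>\<omega>. X i \<omega> j) \<in> borel_measurable P" if "i \<in> {1..n}" "j \<in> {1..p}" for i j
    using measurable_compose[OF Xm[OF that(1)] covar_component_measurable[OF that(2)]] .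
  have B: "B j k \<in> events" if "j \<in> {1..p}" "k \<in> {1..p}" for j k
  proof -
    note [measurable] = Xj[OF _ that(1)] Xj[OF _ that(2)]
    show ?thesis unfolding B_def emp_inner_def by measurable
  qed
  have bound: "prob (B j k) \<le> 2 * exp (- (real n * \<tau>\<^sup>2 / (2 * (K\<^sup>2)\<^sup>2)))"
    if j: "j \<in> {1..p}" and k: "k \<in> {1..p}" for j k
    unfolding B_def emp_inner_def
  proof (rule Hoeffding_average[OF P n _ _ _ _ \<tau>])
    have m: "(\<lambda>z. z j * z k) \<in> borel_measurable (covar_space p)"
      using covar_component_measurable[OF j] covar_component_measurable[OF k]
      by (rule borel_measurable_times)
    show "indep_vars (\<lambda>_. borel) (\<lambda>i \<omega>. X i \<omega> j * X i \<omega> k) {1..n}"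
      by (rule indep_vars_compose2[OF X]) (use m in auto)
    fix i assume i: "i \<in> {1..n}"
    show "expectation (\<lambda>\<omega>. X i \<omega> j * X i \<omega> k) = (\<integral>z. z j * z k \<partial>distr P (covar_space p) (X 1))"
      unfolding ident[OF i, symmetric] using integral_distr[OF Xm[OF i] m] by simp
    have "AE \<omega> in P. \<bar>X i \<omega> l\<bar> \<le> K" if l: "l \<in> {1..p}" for l
    proof (rule AE_identical_distr[OF ident[OF i] Xm[OF i], where Q = "\<lambda>z. \<bar>z l\<bar> \<le> K"])
      show "X 1 \<in> measurable P (covar_space p)" using X1 n by simp
      note [measurable] = covar_component_measurable[OF l]
      show "{z \<in> space (covar_space p). \<bar>z l\<bar> \<le> K} \<in> sets (covar_space p)" by measurable
    qed (rule bnd[OF l])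
    from this[OF j] this[OF k] show "AE \<omega> in P. \<bar>X i \<omega> j * X i \<omega> k\<bar> \<le> K\<^sup>2"
      by eventually_elim (use K in \<open>auto simp: abs_mult power2_eq_square intro!: mult_mono\<close>)
  qed (use K in simp)
  have "prob (\<Union>(j, k)\<in>{1..p} \<times> {1..p}. B j k) \<le> (\<Sum>(j, k)\<in>{1..p} \<times> {1..p}. prob (B j k))"
    using B finite_measure_subadditive_finite[of "{1..p} \<times> {1..p}" "\<lambda>(j, k). B j k"]
    by (auto simp: case_prod_unfold image_subset_iff)
  also have "\<dots> \<le> real (card ({1..p} \<times> {1..p})) * (2 * exp (- (real n * \<tau>\<^sup>2 / (2 * (K\<^sup>2)\<^sup>2))))"
    by (rule sum_bounded_above) (use bound in auto)
  also have "(\<Union>(j, k)\<in>{1..p} \<times> {1..p}. B j k) = {\<omega> \<in> space P. \<exists>j\<in>{1..p}. \<exists>k\<in>{1..p}.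
      \<bar>emp_inner n (\<lambda>i. X i \<omega> j) (\<lambda>i. X i \<omega> k) - (\<integral>z. z j * z k \<partial>distr P (covar_space p) (X 1))\<bar> \<ge> \<tau>}"
    unfolding B_def by auto
  finally show ?thesis by (simp add: card_cartesian_product power2_eq_square)
qed

definition truncate :: "real \<Rightarrow> real \<Rightarrow> real" where
  "truncate T e = (if \<bar>e\<bar> \<le> T then e else 0)"

lemma truncate_measurable [measurable]: "truncate T \<in> borel_measurable borel"
  unfolding truncate_def by measurable

lemma abs_truncate_le: "0 \<le> T \<Longrightarrow> \<bar>truncate T e\<bar> \<le> T" "\<bar>truncate T e\<bar> \<le> \<bar>e\<bar>"
  by (auto simp: truncate_def)

text \<open>
  The first term bounds the probability that some \<open>\<epsilon>\<^sub>i\<close> exceeds \<open>T\<close>. Otherwise the noise agrees with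
  its truncation, and Hoeffding's inequality applies to the independent products of truncated noise
  and covariate. Truncation may destroy the centering: the mean of such a product is the product
  of the two means, and the hypothesis on the truncated mean keeps it below \<open>\<tau>/2\<close>. The other half
  of \<open>\<tau>\<close> is left for the deviation from the mean.
\<close>

lemma noise_correlation_tail:
  fixes X :: "nat \<Rightarrow> 'a \<Rightarrow> nat \<Rightarrow> real" and \<epsilon> :: "nat \<Rightarrow> 'a \<Rightarrow> real"
  assumes P: "prob_space P" and n: "n \<ge> 1"
    and X: "prob_space.indep_vars P (\<lambda>_. covar_space p) X {1..n}"
    and X_ident: "\<And>i. i \<in> {1..n} \<Longrightarrow> distr P (covar_space p) (X i) = distr P (covar_space p) (X 1)"
    and bnd: "\<And>j. j \<in> {1..p} \<Longrightarrow> AE \<omega> in P. \<bar>X 1 \<omega> j\<bar> \<le> K" and K: "0 < K"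
    and eps: "prob_space.indep_vars P (\<lambda>_. borel) \<epsilon> {1..n}"
    and eps_ident: "\<And>i. i \<in> {1..n} \<Longrightarrow> distr P borel (\<epsilon> i) = distr P borel (\<epsilon> 1)"
    and eps_X: "indep_rv P (\<Pi>\<^sub>M i\<in>{1..n}. borel) (\<lambda>\<omega>. \<lambda>i\<in>{1..n}. \<epsilon> i \<omega>)
      (\<Pi>\<^sub>M i\<in>{1..n}. covar_space p) (\<lambda>\<omega>. \<lambda>i\<in>{1..n}. X i \<omega>)"
    and moment: "0 < \<delta>" "integrable P (\<lambda>\<omega>. \<bar>\<epsilon> 1 \<omega>\<bar> powr \<delta>)"
    and T: "0 < T" and \<tau>: "0 < \<tau>"
    and bias: "\<bar>\<integral>\<omega>. truncate T (\<epsilon> 1 \<omega>) \<partial>P\<bar> * K \<le> \<tau> / 2"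
  shows "measure P {\<omega> \<in> space P. \<exists>j\<in>{1..p}. \<bar>emp_inner n (\<lambda>i. \<epsilon> i \<omega>) (\<lambda>i. X i \<omega> j)\<bar> \<ge> \<tau>}
    \<le> real n * ((\<integral>\<omega>. \<bar>\<epsilon> 1 \<omega>\<bar> powr \<delta> \<partial>P) / T powr \<delta>)
      + real p * (2 * exp (- (real n * (\<tau> / 2)\<^sup>2 / (2 * (T * K)\<^sup>2))))"
proof -
  interpret prob_space P by fact
  have one: "1 \<in> {1..n}" using n by simp
  have Xm: "X i \<in> measurable P (covar_space p)" if "i \<in> {1..n}" for i
    using X that by (auto simp: indep_vars_def2)
  have em: "\<epsilon> i \<in> borel_measurable P" if "i \<in> {1..n}" for i
    using eps that by (auto simp: indep_vars_def2)
  have Xj: "(\<lambda>\<omega>. X i \<omega> j) \<in> borel_measurable P" if "i \<in> {1..n}" "j \<in> {1..p}" for i j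
    using measurable_compose[OF Xm[OF that(1)] covar_component_measurable[OF that(2)]] .
  have Xbnd: "AE \<omega> in P. \<bar>X i \<omega> j\<bar> \<le> K" if i: "i \<in> {1..n}" and j: "j \<in> {1..p}" for i j
  proof (rule AE_identical_distr[OF X_ident[OF i] Xm[OF i] Xm[OF one], where Q = "\<lambda>z. \<bar>z j\<bar> \<le> K"])
    note [measurable] = covar_component_measurable[OF j]
    show "{z \<in> space (covar_space p). \<bar>z j\<bar> \<le> K} \<in> sets (covar_space p)" by measurable
  qed (rule bnd[OF j])
  define A where "A i = {\<omega> \<in> space P. \<bar>\<epsilon> i \<omega>\<bar> > T}" for i
  define m where "m = expectation (\<lambda>\<omega>. truncate T (\<epsilon> 1 \<omega>))"
  define \<mu> where "\<mu> j = m * expectation (\<lambda>\<omega>. X 1 \<omega> j)" for j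
  define B where "B j = {\<omega> \<in> space P.
    \<bar>1 / real n * (\<Sum>i\<in>{1..n}. truncate T (\<epsilon> i \<omega>) * X i \<omega> j) - \<mu> j\<bar> \<ge> \<tau> / 2}" for j
  have A: "A i \<in> events" if "i \<in> {1..n}" for i
  proof -
    note [measurable] = em[OF that]
    show ?thesis unfolding A_def by measurable
  qed
  have B: "B j \<in> events" if "j \<in> {1..p}" for j
  proof -
    note [measurable] = em Xj[OF _ that]
    show ?thesis unfolding B_def by measurable
  qed
  have A_le: "prob (A i) \<le> expectation (\<lambda>\<omega>. \<bar>\<epsilon> 1 \<omega>\<bar> powr \<delta>) / T powr \<delta>" if i: "i \<in> {1..n}" for i
  proof -
    have S: "{x::real. \<bar>x\<bar> > T} \<in> sets borel" by measurable
    have "prob (A i) = measure (distr P borel (\<epsilon> i)) {x. \<bar>x\<bar> > T}" if "i \<in> {1..n}" for i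
      using measure_distr[OF em[OF that] S] by (simp add: A_def vimage_def Int_def conj_commute)
    from this[OF i] this[OF one] have "prob (A i) = prob (A 1)" by (simp add: eps_ident[OF i])
    also have "\<dots> \<le> prob {\<omega> \<in> space P. \<bar>\<epsilon> 1 \<omega>\<bar> powr \<delta> \<ge> T powr \<delta>}"
    proof (rule finite_measure_mono)
      show "A 1 \<subseteq> {\<omega> \<in> space P. \<bar>\<epsilon> 1 \<omega>\<bar> powr \<delta> \<ge> T powr \<delta>}"
        unfolding A_def using T moment(1) by (auto intro!: powr_mono2)
      show "{\<omega> \<in> space P. \<bar>\<epsilon> 1 \<omega>\<bar> powr \<delta> \<ge> T powr \<delta>} \<in> events"
        using em[OF one] by simp
    qed
    also have "\<dots> \<le> expectation (\<lambda>\<omega>. \<bar>\<epsilon> 1 \<omega>\<bar> powr \<delta>) / T powr \<delta>"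
      by (rule integral_Markov_inequality_measure[OF moment(2), where A = "{}"]) (use T in auto)
    finally show ?thesis .
  qed
  have \<mu>_le: "\<bar>\<mu> j\<bar> \<le> \<tau> / 2" if j: "j \<in> {1..p}" for j
  proof -
    have "\<bar>expectation (\<lambda>\<omega>. X 1 \<omega> j)\<bar> \<le> expectation (\<lambda>\<omega>. \<bar>X 1 \<omega> j\<bar>)" by (rule integral_abs_bound)
    also have "\<dots> \<le> expectation (\<lambda>\<omega>. K)"
      by (rule integral_mono_AE')
        (use bnd[OF j] K in auto)
    also have "\<dots> = K" by (simp add: prob_space)
    finally have "\<bar>\<mu> j\<bar> \<le> \<bar>m\<bar> * K"
      unfolding \<mu>_def abs_mult by (rule mult_left_mono) simp
    then show ?thesis using bias by (simp add: m_def)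
  qed
  have B_le: "prob (B j) \<le> 2 * exp (- (real n * (\<tau> / 2)\<^sup>2 / (2 * (T * K)\<^sup>2)))" if j: "j \<in> {1..p}" for j
    unfolding B_def
  proof (rule Hoeffding_average[OF P n])
    have "indep_vars (\<lambda>i. borel \<Otimes>\<^sub>M covar_space p) (\<lambda>i \<omega>. (\<epsilon> i \<omega>, X i \<omega>)) {1..n}"
      using indep_vars_Pair[OF P _ eps X eps_X] by simp
    then have "indep_vars (\<lambda>_. borel) (\<lambda>i \<omega>. truncate T (fst (\<epsilon> i \<omega>, X i \<omega>)) * snd (\<epsilon> i \<omega>, X i \<omega>) j) {1..n}"
      by (rule indep_vars_compose2)
        (intro borel_measurable_times measurable_compose[OF measurable_fst truncate_measurable]
          measurable_compose[OF measurable_snd covar_component_measurable[OF j]])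
    then show "indep_vars (\<lambda>_. borel) (\<lambda>i \<omega>. truncate T (\<epsilon> i \<omega>) * X i \<omega> j) {1..n}"
      by simp
    fix i assume i: "i \<in> {1..n}"
    from Xbnd[OF i j] show "AE \<omega> in P. \<bar>truncate T (\<epsilon> i \<omega>) * X i \<omega> j\<bar> \<le> T * K"
      by eventually_elim (use abs_truncate_le(1)[of T] T K in \<open>auto simp: abs_mult intro!: mult_mono\<close>)
    have "indep_var borel (\<lambda>\<omega>. truncate T ((\<lambda>i\<in>{1..n}. \<epsilon> i \<omega>) i)) borel (\<lambda>\<omega>. (\<lambda>i\<in>{1..n}. X i \<omega>) i j)"
    proof (rule indep_rv_imp_indep_var_compose[OF P eps_X])
      show "(\<lambda>u. truncate T (u i)) \<in> borel_measurable (\<Pi>\<^sub>M i\<in>{1..n}. borel)"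
        by (rule measurable_compose[OF measurable_component_singleton[OF i] truncate_measurable])
      show "(\<lambda>v. v i j) \<in> borel_measurable (\<Pi>\<^sub>M i\<in>{1..n}. covar_space p)"
        by (rule measurable_compose[OF measurable_component_singleton[OF i] covar_component_measurable[OF j]])
    qed
    then have ind: "indep_var borel (\<lambda>\<omega>. truncate T (\<epsilon> i \<omega>)) borel (\<lambda>\<omega>. X i \<omega> j)"
      using i by simp
    have "expectation (\<lambda>\<omega>. truncate T (\<epsilon> i \<omega>) * X i \<omega> j)
        = expectation (\<lambda>\<omega>. truncate T (\<epsilon> i \<omega>)) * expectation (\<lambda>\<omega>. X i \<omega> j)"
    proof (rule indep_var_lebesgue_integral[OF ind])
      show "integrable P (\<lambda>\<omega>. truncate T (\<epsilon> i \<omega>))"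
        by (rule integrable_const_bound[where B = T])
          (use abs_truncate_le(1)[of T] T em[OF i] in auto)
      show "integrable P (\<lambda>\<omega>. X i \<omega> j)"
        by (rule integrable_const_bound[where B = K]) (use Xbnd[OF i j] Xj[OF i j] in auto)
    qed
    also have "expectation (\<lambda>\<omega>. truncate T (\<epsilon> i \<omega>)) = m"
      unfolding m_def
      by (rule expectation_identical_distr[OF eps_ident[OF i] em[OF i] em[OF one]]) simp
    also have "expectation (\<lambda>\<omega>. X i \<omega> j) = expectation (\<lambda>\<omega>. X 1 \<omega> j)"
      by (rule expectation_identical_distr[OF X_ident[OF i] Xm[OF i] Xm[OF one]
          covar_component_measurable[OF j]])
    finally show "expectation (\<lambda>\<omega>. truncate T (\<epsilon> i \<omega>) * X i \<omega> j) = \<mu> j"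
      by (simp add: \<mu>_def)
  qed (use T K \<tau> in auto)
  have "{\<omega> \<in> space P. \<exists>j\<in>{1..p}. \<bar>emp_inner n (\<lambda>i. \<epsilon> i \<omega>) (\<lambda>i. X i \<omega> j)\<bar> \<ge> \<tau>}
      \<subseteq> (\<Union>i\<in>{1..n}. A i) \<union> (\<Union>j\<in>{1..p}. B j)" (is "?N \<subseteq> _")
  proof
    fix \<omega> assume "\<omega> \<in> ?N"
    then obtain j where \<omega>: "\<omega> \<in> space P" and j: "j \<in> {1..p}"
      and big: "\<bar>emp_inner n (\<lambda>i. \<epsilon> i \<omega>) (\<lambda>i. X i \<omega> j)\<bar> \<ge> \<tau>" by blast
    show "\<omega> \<in> (\<Union>i\<in>{1..n}. A i) \<union> (\<Union>j\<in>{1..p}. B j)"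
    proof (cases "\<omega> \<in> (\<Union>i\<in>{1..n}. A i)")
      case False
      then have "truncate T (\<epsilon> i \<omega>) = \<epsilon> i \<omega>" if "i \<in> {1..n}" for i
        using that \<omega> by (force simp: A_def truncate_def)
      then have "1 / real n * (\<Sum>i\<in>{1..n}. truncate T (\<epsilon> i \<omega>) * X i \<omega> j)
          = emp_inner n (\<lambda>i. \<epsilon> i \<omega>) (\<lambda>i. X i \<omega> j)"
        unfolding emp_inner_def by simp
      moreover have "\<bar>emp_inner n (\<lambda>i. \<epsilon> i \<omega>) (\<lambda>i. X i \<omega> j) - \<mu> j\<bar> \<ge> \<tau> / 2"
        using big \<mu>_le[OF j] by linarith
      ultimately have "\<omega> \<in> B j" unfolding B_def using \<omega> by simp
      then show ?thesis using j by blast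
    qed blast
  qed
  then have "prob ?N \<le> prob ((\<Union>i\<in>{1..n}. A i) \<union> (\<Union>j\<in>{1..p}. B j))"
    by (rule finite_measure_mono) (use A B in \<open>auto intro!: sets.Un sets.finite_UN\<close>)
  also have "\<dots> \<le> prob (\<Union>i\<in>{1..n}. A i) + prob (\<Union>j\<in>{1..p}. B j)"
    by (rule measure_Un_le) (use A B in \<open>auto intro!: sets.finite_UN\<close>)
  also have "prob (\<Union>i\<in>{1..n}. A i) \<le> (\<Sum>i\<in>{1..n}. prob (A i))"
    by (rule finite_measure_subadditive_finite) (use A in auto)
  also have "(\<Sum>i\<in>{1..n}. prob (A i)) \<le> real (card {1..n}) * (expectation (\<lambda>\<omega>. \<bar>\<epsilon> 1 \<omega>\<bar> powr \<delta>) / T powr \<delta>)"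
    by (rule sum_bounded_above) (rule A_le)
  also have "prob (\<Union>j\<in>{1..p}. B j) \<le> (\<Sum>j\<in>{1..p}. prob (B j))"
    by (rule finite_measure_subadditive_finite) (use B in auto)
  also have "(\<Sum>j\<in>{1..p}. prob (B j)) \<le> real (card {1..p}) * (2 * exp (- (real n * (\<tau> / 2)\<^sup>2 / (2 * (T * K)\<^sup>2))))"
    by (rule sum_bounded_above) (rule B_le)
  finally show ?thesis by simp
qed

section \<open>Uniform laws of large numbers\<close>

lemma second_moments_converge_uniformly:
  fixes X :: "nat \<Rightarrow> nat \<Rightarrow> 'a \<Rightarrow> nat \<Rightarrow> real"
  assumes P: "prob_space P"
    and X: "\<And>n. n \<ge> 1 \<Longrightarrow> prob_space.indep_vars P (\<lambda>_. covar_space (p n)) (X n) {1..n}"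
    and X_ident: "\<And>n i. n \<ge> 1 \<Longrightarrow> i \<in> {1..n} \<Longrightarrow>
      distr P (covar_space (p n)) (X n i) = distr P (covar_space (p n)) (X n 1)"
    and bnd: "\<And>n j. n \<ge> 1 \<Longrightarrow> j \<in> {1..p n} \<Longrightarrow> AE \<omega> in P. \<bar>X n 1 \<omega> j\<bar> \<le> K" and K: "0 < K"
    and p: "0 < \<xi>" "\<xi> < 1" "(\<lambda>n. real (p n)) \<in> O(\<lambda>n. exp (C * real n powr (1 - \<xi>)))"
    and \<tau>: "0 < \<tau>"
  shows "(\<lambda>n. measure P {\<omega> \<in> space P. \<exists>j\<in>{1..p n}. \<exists>k\<in>{1..p n}.
      \<bar>emp_inner n (\<lambda>i. X n i \<omega> j) (\<lambda>i. X n i \<omega> k)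
        - (\<integral>z. z j * z k \<partial>distr P (covar_space (p n)) (X n 1))\<bar> \<ge> \<tau>}) \<longlonglongrightarrow> 0"
proof -
  define c where "c = \<tau>\<^sup>2 / (2 * (K\<^sup>2)\<^sup>2)"
  have c: "0 < c" using \<tau> K by (simp add: c_def)
  have "(\<lambda>n. 2 * ((real (p n))\<^sup>2 * exp (- (c * real n powr (1 - 0))))) \<longlonglongrightarrow> 2 * 0"
    by (intro tendsto_intros subexponential_dimension_union_bound[OF p(3)] p c)
  then have lim: "(\<lambda>n. 2 * ((real (p n))\<^sup>2 * exp (- (c * real n powr (1 - 0))))) \<longlonglongrightarrow> 0" by simp
  show ?thesis
  proof (rule tendsto_sandwich[OF _ _ tendsto_const lim])
    show "\<forall>\<^sub>F n in sequentially. measure P {\<omega> \<in> space P. \<exists>j\<in>{1..p n}. \<exists>k\<in>{1..p n}.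
        \<bar>emp_inner n (\<lambda>i. X n i \<omega> j) (\<lambda>i. X n i \<omega> k)
          - (\<integral>z. z j * z k \<partial>distr P (covar_space (p n)) (X n 1))\<bar> \<ge> \<tau>}
        \<le> 2 * ((real (p n))\<^sup>2 * exp (- (c * real n powr (1 - 0))))"
      using eventually_ge_at_top[of 1]
    proof eventually_elim
      case (elim n)
      note empirical_second_moment_tail[OF P elim X[OF elim] X_ident[OF elim] bnd[OF elim] K less_imp_le[OF \<tau>]]
      also have "(real (p n))\<^sup>2 * (2 * exp (- (real n * \<tau>\<^sup>2 / (2 * (K\<^sup>2)\<^sup>2))))
          = 2 * ((real (p n))\<^sup>2 * exp (- (c * real n powr (1 - 0))))"
        using elim by (simp add: c_def mult.commute)
      finally show ?case .
    qed
  qed simp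
qed

lemma truncated_mean_tendsto:
  assumes "integrable P (e :: 'a \<Rightarrow> real)" and T: "filterlim T at_top sequentially"
  shows "(\<lambda>n. \<integral>\<omega>. truncate (T n) (e \<omega>) \<partial>P) \<longlonglongrightarrow> (\<integral>\<omega>. e \<omega> \<partial>P)"
proof (rule integral_dominated_convergence[where w = "\<lambda>\<omega>. \<bar>e \<omega>\<bar>"])
  show "AE \<omega> in P. (\<lambda>n. truncate (T n) (e \<omega>)) \<longlonglongrightarrow> e \<omega>"
  proof (intro AE_I2 tendsto_eventually)
    fix \<omega>
    have "\<forall>\<^sub>F n in sequentially. T n \<ge> \<bar>e \<omega>\<bar>" using T by (simp add: filterlim_at_top)
    then show "\<forall>\<^sub>F n in sequentially. truncate (T n) (e \<omega>) = e \<omega>"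
      by eventually_elim (simp add: truncate_def)
  qed
qed (use assms in \<open>auto simp: abs_truncate_le\<close>)

text \<open>
  At the truncation level \<open>T = n\<^sup>\<xi>\<^sup>/\<^sup>4\<close> the probability that the truncation acts is of order
  \<open>n T\<^sup>-\<^sup>\<delta> = n\<^sup>1\<^sup>-\<^sup>\<delta>\<^sup>\<xi>\<^sup>/\<^sup>4\<close>, and Hoeffding's exponent is of order \<open>n/T\<^sup>2 = n\<^sup>1\<^sup>-\<^sup>\<xi>\<^sup>/\<^sup>2\<close>, which still
  dominates \<open>log p\<close>.
\<close>

lemma noise_correlations_vanish:
  fixes X :: "nat \<Rightarrow> nat \<Rightarrow> 'a \<Rightarrow> nat \<Rightarrow> real" and \<epsilon> :: "nat \<Rightarrow> 'a \<Rightarrow> real"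
  assumes P: "prob_space P"
    and X: "\<And>n. n \<ge> 1 \<Longrightarrow> prob_space.indep_vars P (\<lambda>_. covar_space (p n)) (X n) {1..n}"
    and X_ident: "\<And>n i. n \<ge> 1 \<Longrightarrow> i \<in> {1..n} \<Longrightarrow>
      distr P (covar_space (p n)) (X n i) = distr P (covar_space (p n)) (X n 1)"
    and bnd: "\<And>n j. n \<ge> 1 \<Longrightarrow> j \<in> {1..p n} \<Longrightarrow> AE \<omega> in P. \<bar>X n 1 \<omega> j\<bar> \<le> K" and K: "0 < K"
    and eps: "prob_space.indep_vars P (\<lambda>_. borel) \<epsilon> {1..}"
    and eps_ident: "\<And>i. i \<ge> 1 \<Longrightarrow> distr P borel (\<epsilon> i) = distr P borel (\<epsilon> 1)"
    and eps_centered: "prob_space.expectation P (\<epsilon> 1) = 0"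
    and eps_X: "\<And>n. n \<ge> 1 \<Longrightarrow> indep_rv P (\<Pi>\<^sub>M i\<in>{1..n}. borel) (\<lambda>\<omega>. \<lambda>i\<in>{1..n}. \<epsilon> i \<omega>)
      (\<Pi>\<^sub>M i\<in>{1..n}. covar_space (p n)) (\<lambda>\<omega>. \<lambda>i\<in>{1..n}. X n i \<omega>)"
    and p: "0 < \<xi>" "\<xi> < 1" "(\<lambda>n. real (p n)) \<in> O(\<lambda>n. exp (C * real n powr (1 - \<xi>)))"
    and moment: "\<delta> > 4 / \<xi>" "integrable P (\<lambda>\<omega>. \<bar>\<epsilon> 1 \<omega>\<bar> powr \<delta>)"
    and \<tau>: "0 < \<tau>"
  shows "(\<lambda>n. measure P {\<omega> \<in> space P. \<exists>j\<in>{1..p n}.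
      \<bar>emp_inner n (\<lambda>i. \<epsilon> i \<omega>) (\<lambda>i. X n i \<omega> j)\<bar> \<ge> \<tau>}) \<longlonglongrightarrow> 0"
proof -
  interpret prob_space P by fact
  have e1: "\<epsilon> 1 \<in> borel_measurable P" using eps by (auto simp: indep_vars_def2)
  have "4 / \<xi> > 1" using p by simp
  then have \<delta>: "1 < \<delta>" using moment(1) by linarith
  have e_int: "integrable P (\<epsilon> 1)"
  proof (rule Bochner_Integration.integrable_bound)
    show "integrable P (\<lambda>\<omega>. 1 + \<bar>\<epsilon> 1 \<omega>\<bar> powr \<delta>)" using moment(2) by simp
    have "\<bar>x\<bar> \<le> 1 + \<bar>x\<bar> powr \<delta>" for x :: real
    proof (cases "\<bar>x\<bar> \<le> 1")
      case False
      then have "\<bar>x\<bar> powr 1 \<le> \<bar>x\<bar> powr \<delta>" using \<delta> by (intro powr_mono) auto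
      then show ?thesis by simp
    qed (simp add: add_increasing2)
    then show "AE \<omega> in P. norm (\<epsilon> 1 \<omega>) \<le> norm (1 + \<bar>\<epsilon> 1 \<omega>\<bar> powr \<delta>)" by simp
  qed (rule e1)
  define T where "T n = real n powr (\<xi> / 4)" for n
  have T_top: "filterlim T at_top sequentially" unfolding T_def using p by real_asymp
  have bias: "(\<lambda>n. \<bar>\<integral>\<omega>. truncate (T n) (\<epsilon> 1 \<omega>) \<partial>P\<bar> * K) \<longlonglongrightarrow> \<bar>0\<bar> * K"
    using truncated_mean_tendsto[OF e_int T_top] unfolding eps_centered by (intro tendsto_intros)
  have bias_ev: "\<forall>\<^sub>F n in sequentially. \<bar>\<integral>\<omega>. truncate (T n) (\<epsilon> 1 \<omega>) \<partial>P\<bar> * K < \<tau> / 2"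
    by (rule order_tendstoD(2)[OF bias]) (use \<tau> in simp)
  define E where "E = expectation (\<lambda>\<omega>. \<bar>\<epsilon> 1 \<omega>\<bar> powr \<delta>)"
  define c where "c = (\<tau> / 2)\<^sup>2 / (2 * K\<^sup>2)"
  have c: "0 < c" using \<tau> K by (simp add: c_def)
  define U where "U n = E * real n powr (1 - \<delta> * \<xi> / 4)
    + 2 * ((real (p n))\<^sup>2 * exp (- (c * real n powr (1 - \<xi> / 2))))" for n
  have "\<delta> * \<xi> > 4" using moment(1) p by (simp add: field_simps)
  then have "(\<lambda>n. real n powr (1 - \<delta> * \<xi> / 4)) \<longlonglongrightarrow> 0" by real_asymp
  then have "U \<longlonglongrightarrow> E * 0 + 2 * 0"
    unfolding U_def
    by (intro tendsto_intros subexponential_dimension_union_bound[OF p(3)] c) (use p in auto)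
  then have U: "U \<longlonglongrightarrow> 0" by simp
  show ?thesis
  proof (rule tendsto_sandwich[OF _ _ tendsto_const U])
    show "\<forall>\<^sub>F n in sequentially. prob {\<omega> \<in> space P. \<exists>j\<in>{1..p n}.
        \<bar>emp_inner n (\<lambda>i. \<epsilon> i \<omega>) (\<lambda>i. X n i \<omega> j)\<bar> \<ge> \<tau>} \<le> U n"
      using eventually_ge_at_top[of 1] bias_ev
    proof eventually_elim
      case (elim n)
      have T: "0 < T n" using elim(1) by (simp add: T_def)
      have eps': "indep_vars (\<lambda>_. borel) \<epsilon> {1..n}" by (rule indep_vars_subset[OF eps]) auto
      have "prob {\<omega> \<in> space P. \<exists>j\<in>{1..p n}. \<bar>emp_inner n (\<lambda>i. \<epsilon> i \<omega>) (\<lambda>i. X n i \<omega> j)\<bar> \<ge> \<tau>}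
          \<le> real n * (E / T n powr \<delta>)
            + real (p n) * (2 * exp (- (real n * (\<tau> / 2)\<^sup>2 / (2 * (T n * K)\<^sup>2))))"
        unfolding E_def
        by (rule noise_correlation_tail[OF P elim(1) X[OF elim(1)] X_ident[OF elim(1)] bnd[OF elim(1)] K
              eps' eps_ident eps_X[OF elim(1)] _ moment(2) T \<tau>])
          (use elim(2) \<delta> in auto)
      also have "real n * (E / T n powr \<delta>) = E * real n powr (1 - \<delta> * \<xi> / 4)"
        using elim(1) by (simp add: T_def powr_powr powr_diff mult.commute)
      also have "real n * (\<tau> / 2)\<^sup>2 / (2 * (T n * K)\<^sup>2) = c * real n powr (1 - \<xi> / 2)"
      proof -
        have "(T n)\<^sup>2 = real n powr (\<xi> / 2)"
          using elim(1) by (simp add: T_def power2_eq_square flip: powr_add)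
        then show ?thesis
          using elim(1) K by (simp add: c_def power_mult_distrib powr_diff mult_ac)
      qed
      also have "real (p n) * (2 * exp (- (c * real n powr (1 - \<xi> / 2))))
          \<le> (real (p n))\<^sup>2 * (2 * exp (- (c * real n powr (1 - \<xi> / 2))))"
        using le_square[of "p n"]
        by (intro mult_right_mono) (auto simp: power2_eq_square simp flip: of_nat_mult)
      finally show ?case by (simp add: U_def)
    qed
  qed simp
qed

section \<open>The boosting model as a random function\<close>

text \<open>
  The fitted coefficient of the selected variable is a finite sum over all variables of measurable
  coefficients times indicators of selection. A representation of the model by
  measurable coefficients is what makes its prediction error a random variable.
\<close>

lemma boost_model_measurable_coefficients:
  fixes X :: "nat \<Rightarrow> 'a \<Rightarrow> nat \<Rightarrow> real"
  assumes X: "\<And>i j. i \<in> {1..n} \<Longrightarrow> j \<in> {1..p} \<Longrightarrow> (\<lambda>\<omega>. X i \<omega> j) \<in> borel_measurable P"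
    and Y: "\<And>i. i \<in> {1..n} \<Longrightarrow> Y i \<in> borel_measurable P"
    and s: "\<And>m. m \<ge> 1 \<Longrightarrow> s m \<in> measurable P (count_space UNIV)"
    and s_range: "\<And>m \<omega>. m \<ge> 1 \<Longrightarrow> \<omega> \<in> space P \<Longrightarrow> s m \<omega> \<in> {1..p}"
  shows "\<exists>c. (\<forall>j. c j \<in> borel_measurable P) \<and> (\<forall>\<omega>\<in>space P. \<forall>z.
    boost_model 1 n (\<lambda>i. X i \<omega>) (\<lambda>i. Y i \<omega>) (\<lambda>m. s m \<omega>) m z = (\<Sum>j\<in>{1..p}. c j \<omega> * z j))"
proof (induction m)
  case 0
  show ?case by (rule exI[of _ "\<lambda>_ _. 0"]) simp
next
  case (Suc m)
  then obtain c where c: "\<And>j. c j \<in> borel_measurable P"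
    and bm: "\<And>\<omega> z. \<omega> \<in> space P \<Longrightarrow>
      boost_model 1 n (\<lambda>i. X i \<omega>) (\<lambda>i. Y i \<omega>) (\<lambda>m. s m \<omega>) m z = (\<Sum>j\<in>{1..p}. c j \<omega> * z j)"
    by auto
  define e where "e j \<omega> = emp_inner n (\<lambda>i. Y i \<omega> - (\<Sum>k\<in>{1..p}. c k \<omega> * X i \<omega> k)) (\<lambda>i. X i \<omega> j)" for j \<omega>
  define c' where "c' j \<omega> = c j \<omega> + (if j \<in> {1..p} then e j \<omega> * (if s (Suc m) \<omega> = j then 1 else 0) else 0)" for j \<omega>
  have e: "e j \<in> borel_measurable P" if "j \<in> {1..p}" for j
    unfolding e_def[abs_def] emp_inner_def
    by (intro borel_measurable_times borel_measurable_sum borel_measurable_diff borel_measurable_const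
        X Y c that)
  have ind: "(\<lambda>\<omega>. if s (Suc m) \<omega> = j then 1 else 0 :: real) \<in> borel_measurable P" for j
  proof -
    note [measurable] = s[of "Suc m", simplified]
    show ?thesis by measurable
  qed
  have c': "c' j \<in> borel_measurable P" for j
    using c[of j] e[of j] ind[of j] unfolding c'_def[abs_def] by (cases "j \<in> {1..p}") auto
  moreover have "boost_model 1 n (\<lambda>i. X i \<omega>) (\<lambda>i. Y i \<omega>) (\<lambda>m. s m \<omega>) (Suc m) z
      = (\<Sum>j\<in>{1..p}. c' j \<omega> * z j)" if \<omega>: "\<omega> \<in> space P" for \<omega> z
  proof -
    have j: "s (Suc m) \<omega> \<in> {1..p}" by (rule s_range) (use \<omega> in auto)
    have "(\<Sum>j\<in>{1..p}. c' j \<omega> * z j)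
        = (\<Sum>j\<in>{1..p}. c j \<omega> * z j) + (\<Sum>j\<in>{1..p}. if s (Suc m) \<omega> = j then e j \<omega> * z j else 0)"
      unfolding sum.distrib[symmetric] by (rule sum.cong) (auto simp: c'_def algebra_simps)
    also have "(\<Sum>j\<in>{1..p}. if s (Suc m) \<omega> = j then e j \<omega> * z j else 0)
        = e (s (Suc m) \<omega>) \<omega> * z (s (Suc m) \<omega>)"
      using j by simp
    finally show ?thesis
      by (simp add: bm[OF \<omega>] ls_fit_def baselearner_def e_def)
  qed
  ultimately show ?case by blast
qed

lemma singboost_selection_range:
  "singboost_selection L M \<kappa> n p x y s \<Longrightarrow> m \<ge> 1 \<Longrightarrow> s m \<in> {1..p}"
  by (auto simp: singboost_selection_def is_arg_min_def Let_def)

section \<open>Consistency\<close>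

text \<open>
  Collects the error bounds into one term that vanishes as \<open>k\<close> grows and one that vanishes with
  \<open>\<sigma>\<close>. The bound \<open>2\<^sup>k\<tau> \<le> \<sigma>\<close> controls the accumulated noise, and also the growing
  \<open>\<ell>\<^sup>1\<close>-norm in the last summand, since \<open>1 + k \<le> 2\<^sup>k\<close>.
\<close>

lemma boosting_error_rate:
  fixes a B \<tau> \<sigma> :: real and k :: nat
  assumes "0 < a" "0 \<le> B" "0 \<le> \<tau>" "\<tau> \<le> 1" "2 ^ k * \<tau> \<le> \<sigma>" "\<sigma> \<le> 1"
  shows "2 * (sqrt 2 * (2 * B + \<tau>)\<^sup>2 / (a * sqrt (harm k))) + 2 * ((2 ^ k - 1) * \<tau>)\<^sup>2
      + ((2 * B + \<tau>) * sqrt (2 * (1 + real k)) + (2 ^ k - 1) * \<tau>)\<^sup>2 * \<tau>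
    \<le> 4 * (2 * B + 1)\<^sup>2 / (a * sqrt (harm k)) + (4 * (2 * B + 1)\<^sup>2 + 4) * \<sigma>"
proof -
  define b where "b = (2 * B + \<tau>)\<^sup>2"
  define c where "c = (2 * B + 1)\<^sup>2"
  define v where "v = (2 ^ k - 1) * \<tau>"
  have pow: "1 + real k \<le> 2 ^ k" by (induction k) auto
  have b: "0 \<le> b" "b \<le> c" using assms by (auto simp: b_def c_def intro!: power_mono)
  have "0 \<le> v" "v \<le> 2 ^ k * \<tau>"
    unfolding v_def using assms(3) by (auto intro!: mult_right_mono)
  then have v: "0 \<le> v" "v \<le> \<sigma>" using assms(5) by auto
  have \<sigma>: "0 \<le> \<sigma>" using v by linarith
  have v2: "v\<^sup>2 \<le> \<sigma>"
    using v assms(6) mult_mono[of v \<sigma> v 1] by (simp add: power2_eq_square)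
  have "2 * (sqrt 2 * b / (a * sqrt (harm k))) = (2 * sqrt 2) * b / (a * sqrt (harm k))" by simp
  also have "\<dots> \<le> 4 * c / (a * sqrt (harm k))"
  proof (intro divide_right_mono mult_mono)
    show "2 * sqrt 2 \<le> (4 :: real)"
      using real_sqrt_le_mono[of 2 4] by simp
  qed (use b assms(1) in \<open>auto simp: harm_nonneg\<close>)
  finally have 1: "2 * (sqrt 2 * b / (a * sqrt (harm k))) \<le> 4 * c / (a * sqrt (harm k))" .
  have "((2 * B + \<tau>) * sqrt (2 * (1 + real k)) + v)\<^sup>2
      \<le> 2 * ((2 * B + \<tau>) * sqrt (2 * (1 + real k)))\<^sup>2 + 2 * v\<^sup>2"
    using zero_le_power2[of "(2 * B + \<tau>) * sqrt (2 * (1 + real k)) - v"]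
    by (simp only: power2_sum power2_diff)
  also have "\<dots> = 4 * b * (1 + real k) + 2 * v\<^sup>2"
    by (simp add: power_mult_distrib b_def)
  finally have "((2 * B + \<tau>) * sqrt (2 * (1 + real k)) + v)\<^sup>2 * \<tau>
      \<le> (4 * b * (1 + real k) + 2 * v\<^sup>2) * \<tau>"
    using assms(3) by (rule mult_right_mono)
  also have "\<dots> = 4 * b * ((1 + real k) * \<tau>) + 2 * v\<^sup>2 * \<tau>" by (simp add: algebra_simps)
  also have "\<dots> \<le> 4 * c * \<sigma> + 2 * \<sigma> * 1"
  proof (intro add_mono mult_mono)
    have "(1 + real k) * \<tau> \<le> 2 ^ k * \<tau>" using pow assms(3) by (rule mult_right_mono)
    then show "(1 + real k) * \<tau> \<le> \<sigma>" using assms(5) by linarith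
  qed (use b v2 \<sigma> assms in auto)
  finally show ?thesis
    using 1 v2 unfolding b_def[symmetric] c_def[symmetric] v_def[symmetric]
    by (simp add: algebra_simps)
qed

lemma esssup_bound_imp_AE:
  assumes "(SUP n\<in>N. SUP j\<in>J n. esssup P (\<lambda>\<omega>. ereal \<bar>Z n j \<omega>\<bar>)) < \<infinity>"
  obtains K where "0 < K" "\<And>n j. n \<in> N \<Longrightarrow> j \<in> J n \<Longrightarrow> AE \<omega> in P. \<bar>Z n j \<omega>\<bar> \<le> K"
proof -
  obtain k :: nat where k: "(SUP n\<in>N. SUP j\<in>J n. esssup P (\<lambda>\<omega>. ereal \<bar>Z n j \<omega>\<bar>)) < ereal (real k)"
    using assms less_PInf_Ex_of_nat by auto
  show ?thesis
  proof (rule that[of "real k + 1"])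
    fix n j assume "n \<in> N" "j \<in> J n"
    then have "esssup P (\<lambda>\<omega>. ereal \<bar>Z n j \<omega>\<bar>) < ereal (real k)"
      using SUP_lessD[OF SUP_lessD[OF k]] by blast
    moreover have "AE \<omega> in P. ereal \<bar>Z n j \<omega>\<bar> \<le> esssup P (\<lambda>\<omega>. ereal \<bar>Z n j \<omega>\<bar>)"
      by (rule esssup_AE)
    ultimately have "AE \<omega> in P. ereal \<bar>Z n j \<omega>\<bar> < ereal (real k)"
      by (auto elim!: eventually_mono simp del: ereal_less_eq less_ereal.simps intro: le_less_trans)
    then show "AE \<omega> in P. \<bar>Z n j \<omega>\<bar> \<le> real k + 1" by eventually_elim simp
  qed simp
qed

theorem theorem6p1:
  fixes P :: "'a measure"
    and p :: "nat \<Rightarrow> nat"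
    and \<beta> :: "nat \<Rightarrow> nat \<Rightarrow> real"
    and X :: "nat \<Rightarrow> nat \<Rightarrow> 'a \<Rightarrow> nat \<Rightarrow> real"
    and Xnew :: "nat \<Rightarrow> 'a \<Rightarrow> nat \<Rightarrow> real"
    and \<epsilon> :: "nat \<Rightarrow> 'a \<Rightarrow> real"
    and Y :: "nat \<Rightarrow> nat \<Rightarrow> 'a \<Rightarrow> real"
    and f :: "nat \<Rightarrow> (nat \<Rightarrow> real) \<Rightarrow> real"
    and L :: "real list \<Rightarrow> real list \<Rightarrow> real"
    and M :: nat
    and jhat :: "nat \<Rightarrow> nat \<Rightarrow> 'a \<Rightarrow> nat"
    and fhat :: "nat \<Rightarrow> nat \<Rightarrow> 'a \<Rightarrow> (nat \<Rightarrow> real) \<Rightarrow> real"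
    and R :: "nat \<Rightarrow> nat \<Rightarrow> 'a \<Rightarrow> (nat \<Rightarrow> real) \<Rightarrow> real"
    and \<xi> C \<delta> :: real
  assumes P: "prob_space P"
    and p: "\<And>n. n \<ge> 1 \<Longrightarrow> p n \<ge> 1"
    \<comment> \<open>the model\<close>
    and f: "\<And>n. f n = linear_model (p n) (\<beta> n)"
    and Y: "\<And>n i \<omega>. n \<ge> 1 \<Longrightarrow> i \<in> {1..n} \<Longrightarrow> \<omega> \<in> space P \<Longrightarrow> Y n i \<omega> = f n (X n i \<omega>) + \<epsilon> i \<omega>"
    and X_indep: "\<And>n. n \<ge> 1 \<Longrightarrow> prob_space.indep_vars P (\<lambda>_. covar_space (p n)) (X n) {1..n}"
    and X_ident: "\<And>n i. n \<ge> 1 \<Longrightarrow> i \<in> {1..n} \<Longrightarrow>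
          distr P (covar_space (p n)) (X n i) = distr P (covar_space (p n)) (X n 1)"
    and X_second_moment: "\<And>n j. n \<ge> 1 \<Longrightarrow> j \<in> {1..p n} \<Longrightarrow>
          prob_space.expectation P (\<lambda>\<omega>. \<bar>X n 1 \<omega> j\<bar>\<^sup>2) = 1"
    and eps_indep: "prob_space.indep_vars P (\<lambda>_. borel) \<epsilon> {1..}"
    and eps_ident: "\<And>i. i \<ge> 1 \<Longrightarrow> distr P borel (\<epsilon> i) = distr P borel (\<epsilon> 1)"
    and eps_centered: "\<And>i. i \<ge> 1 \<Longrightarrow> prob_space.expectation P (\<epsilon> i) = 0"
    and eps_indep_X: "\<And>n. n \<ge> 1 \<Longrightarrow>
          indep_rv P (\<Pi>\<^sub>M i\<in>{1..n}. borel) (\<lambda>\<omega>. \<lambda>i\<in>{1..n}. \<epsilon> i \<omega>)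
                     (\<Pi>\<^sub>M i\<in>{1..n}. covar_space (p n)) (\<lambda>\<omega>. \<lambda>i\<in>{1..n}. X n i \<omega>)"
    \<comment> \<open>the new observation\<close>
    and Xnew_distr: "\<And>n. n \<ge> 1 \<Longrightarrow>
          distr P (covar_space (p n)) (Xnew n) = distr P (covar_space (p n)) (X n 1)"
    and Xnew_indep: "\<And>n. n \<ge> 1 \<Longrightarrow>
          indep_rv P (covar_space (p n)) (Xnew n)
                     (\<Pi>\<^sub>M i\<in>{1..n}. covar_space (p n)) (\<lambda>\<omega>. \<lambda>i\<in>{1..n}. X n i \<omega>)"
    \<comment> \<open>normalized baselearners\<close>
    and normalized: "\<And>n j. n \<ge> 1 \<Longrightarrow> j \<in> {1..p n} \<Longrightarrow>
          AE \<omega> in P. emp_inner n (\<lambda>i. baselearner j (X n i \<omega>)) (\<lambda>i. baselearner j (X n i \<omega>)) = 1"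
    \<comment> \<open>SingBoost and the iterative scheme, both with step size one\<close>
    and M: "M \<ge> 1"
    and jhat_measurable: "\<And>n m. n \<ge> 1 \<Longrightarrow> m \<ge> 1 \<Longrightarrow> jhat n m \<in> measurable P (count_space UNIV)"
    and jhat: "\<And>n \<omega>. n \<ge> 1 \<Longrightarrow> \<omega> \<in> space P \<Longrightarrow>
          singboost_selection L M 1 n (p n) (\<lambda>i. X n i \<omega>) (\<lambda>i. Y n i \<omega>) (\<lambda>m. jhat n m \<omega>)"
    and fhat: "\<And>n m \<omega>. fhat n m \<omega> =
          boost_model 1 n (\<lambda>i. X n i \<omega>) (\<lambda>i. Y n i \<omega>) (\<lambda>m. jhat n m \<omega>) m"
    and R: "\<And>n m \<omega>. R n m \<omega> =
          emp_scheme n (\<lambda>i. X n i \<omega>) (\<lambda>i. Y n i \<omega>) (\<lambda>m. jhat n m \<omega>) (f n) m"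
    \<comment> \<open>assumptions (E1) to (E5)\<close>
    and E1: "0 < \<xi>" "\<xi> < 1" "0 < C" "(\<lambda>n. real (p n)) \<in> O(\<lambda>n. exp (C * real n powr (1 - \<xi>)))"
    and E2: "(SUP n\<in>{1..}. ereal (\<Sum>j\<in>{1..p n}. \<bar>\<beta> n j\<bar>)) < \<infinity>"
    and E3: "(SUP n\<in>{1..}. SUP j\<in>{1..p n}. esssup P (\<lambda>\<omega>. ereal \<bar>X n 1 \<omega> j\<bar>)) < \<infinity>"
    and E4: "\<delta> > 4 / \<xi>" "integrable P (\<lambda>\<omega>. \<bar>\<epsilon> 1 \<omega>\<bar> powr \<delta>)"
    and E5: "\<exists>a>0. \<forall>n\<ge>1. \<forall>m\<ge>1. AE \<omega> in P. \<exists>Ct\<ge>a.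
          \<bar>emp_inner n (\<lambda>i. R n (m - 1) \<omega> (X n i \<omega>)) (\<lambda>i. baselearner (jhat n m \<omega>) (X n i \<omega>))\<bar>
          \<ge> Ct * (SUP j\<in>{1..p n}.
                 \<bar>emp_inner n (\<lambda>i. R n (m - 1) \<omega> (X n i \<omega>)) (\<lambda>i. baselearner j (X n i \<omega>))\<bar>)"
  shows "\<exists>r :: nat \<Rightarrow> nat. filterlim r at_top sequentially \<and>
          (\<forall>m :: nat \<Rightarrow> nat. filterlim m at_top sequentially \<longrightarrow> (\<forall>n. m n \<le> r n) \<longrightarrow>
             small_o_P_one P (\<lambda>n \<omega>.
               \<integral>x. \<bar>fhat n (m n) \<omega> x - f n x\<bar>\<^sup>2 \<partial>(distr P (covar_space (p n)) (Xnew n))))"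
proof -
  interpret prob_space P by (rule P)
  \<comment> \<open>The suprema are extended reals; being finite, they lie below some natural number.\<close>
  obtain N2 :: nat where N2: "(SUP n\<in>{1..}. ereal (\<Sum>j\<in>{1..p n}. \<bar>\<beta> n j\<bar>)) < ereal (real N2)"
    using E2 less_PInf_Ex_of_nat by auto
  define B where "B = real N2"
  have B: "(\<Sum>j\<in>{1..p n}. \<bar>\<beta> n j\<bar>) \<le> B" if "n \<ge> 1" for n
    using SUP_lessD[OF N2, of n] that by (simp add: B_def)
  have B0: "0 \<le> B" by (simp add: B_def)
  have f_ball: "f n \<in> l1_ball (p n) B" if "n \<ge> 1" for n
    unfolding l1_ball_def f using B[OF that] by blast
  obtain K where K: "0 < K" and bnd': "\<And>n j. n \<in> {1..} \<Longrightarrow> j \<in> {1..p n} \<Longrightarrow> AE \<omega> in P. \<bar>X n 1 \<omega> j\<bar> \<le> K"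
    using esssup_bound_imp_AE[OF E3] by blast
  have bnd: "AE \<omega> in P. \<bar>X n 1 \<omega> j\<bar> \<le> K" if "n \<ge> 1" "j \<in> {1..p n}" for n j
    using bnd'[of n j] that by simp
  obtain a where a: "0 < a" and E5': "\<And>n m. n \<ge> 1 \<Longrightarrow> m \<ge> 1 \<Longrightarrow> AE \<omega> in P. \<exists>Ct\<ge>a.
      \<bar>emp_inner n (\<lambda>i. R n (m - 1) \<omega> (X n i \<omega>)) (\<lambda>i. baselearner (jhat n m \<omega>) (X n i \<omega>))\<bar>
      \<ge> Ct * (SUP j\<in>{1..p n}.
             \<bar>emp_inner n (\<lambda>i. R n (m - 1) \<omega> (X n i \<omega>)) (\<lambda>i. baselearner j (X n i \<omega>))\<bar>)"
    using E5 by blast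
  have jhat_range: "jhat n m \<omega> \<in> {1..p n}" if "n \<ge> 1" "m \<ge> 1" "\<omega> \<in> space P" for n m \<omega>
    using singboost_selection_range[OF jhat[OF that(1,3)] that(2)] .
  have Xm: "X n i \<in> measurable P (covar_space (p n))" if "n \<ge> 1" "i \<in> {1..n}" for n i
    using X_indep[OF that(1)] that(2) by (auto simp: indep_vars_def2)
  have Xj: "(\<lambda>\<omega>. X n i \<omega> j) \<in> borel_measurable P" if "n \<ge> 1" "i \<in> {1..n}" "j \<in> {1..p n}" for n i j
    using measurable_compose[OF Xm[OF that(1,2)] covar_component_measurable[OF that(3)]] .
  have em: "\<epsilon> i \<in> borel_measurable P" if "i \<ge> 1" for i
    using eps_indep that by (auto simp: indep_vars_def2)
  have Ym: "Y n i \<in> borel_measurable P" if n: "n \<ge> 1" and i: "i \<in> {1..n}" for n i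
  proof -
    have "(\<lambda>\<omega>. (\<Sum>j\<in>{1..p n}. \<beta> n j * X n i \<omega> j) + \<epsilon> i \<omega>) \<in> borel_measurable P"
      using Xj[OF n i] em[of i] i by (intro borel_measurable_add borel_measurable_sum borel_measurable_times) auto
    then show ?thesis
      by (subst measurable_cong[where g = "\<lambda>\<omega>. (\<Sum>j\<in>{1..p n}. \<beta> n j * X n i \<omega> j) + \<epsilon> i \<omega>"])
        (simp_all add: Y[OF n i] f linear_model_def)
  qed
  define \<mu> where "\<mu> n = distr P (covar_space (p n)) (X n 1)" for n
  have \<mu>: "distr P (covar_space (p n)) (Xnew n) = \<mu> n" if "n \<ge> 1" for n
    using Xnew_distr[OF that] by (simp add: \<mu>_def)
  have \<mu>_int: "integrable (\<mu> n) (\<lambda>z. z j * z k)" if n: "n \<ge> 1" and j: "j \<in> {1..p n}" and k: "k \<in> {1..p n}" for n j k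
  proof -
    have X1: "X n 1 \<in> measurable P (covar_space (p n))" using Xm[OF n] n by simp
    have "integrable P (\<lambda>\<omega>. X n 1 \<omega> j * X n 1 \<omega> k)"
    proof (rule integrable_const_bound[where B = "K * K"])
      show "AE \<omega> in P. norm (X n 1 \<omega> j * X n 1 \<omega> k) \<le> K * K"
        using bnd[OF n j] bnd[OF n k]
        by eventually_elim (use K in \<open>auto simp: abs_mult intro!: mult_mono\<close>)
    qed (use Xj[OF n, of 1] n j k in auto)
    then show ?thesis
      unfolding \<mu>_def
      by (subst integrable_distr_eq[OF X1 borel_measurable_times[OF covar_component_measurable[OF j]
          covar_component_measurable[OF k]]])
  qed
  define Z where "Z n m \<omega> = (\<integral>x. \<bar>fhat n m \<omega> x - f n x\<bar>\<^sup>2 \<partial>\<mu> n)" for n m \<omega>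
  have Z_eq: "(\<integral>x. \<bar>fhat n m \<omega> x - f n x\<bar>\<^sup>2 \<partial>(distr P (covar_space (p n)) (Xnew n))) = Z n m \<omega>"
    if "n \<ge> 1" for n m \<omega>
    unfolding Z_def \<mu>[OF that] ..
  have Z_meas: "Z n m \<in> borel_measurable P" if n: "n \<ge> 1" for n m
  proof -
    have "\<exists>c. (\<forall>j. c j \<in> borel_measurable P) \<and> (\<forall>\<omega>\<in>space P. \<forall>z.
        fhat n m \<omega> z = (\<Sum>j\<in>{1..p n}. c j \<omega> * z j))"
      unfolding fhat
      by (rule boost_model_measurable_coefficients[where X = "X n" and Y = "Y n" and s = "jhat n",
            OF Xj[OF n] Ym[OF n] jhat_measurable[OF n] jhat_range[OF n]])
    then obtain c where c: "\<And>j. c j \<in> borel_measurable P"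
      and fhat_c: "\<And>\<omega> z. \<omega> \<in> space P \<Longrightarrow> fhat n m \<omega> z = (\<Sum>j\<in>{1..p n}. c j \<omega> * z j)"
      by blast
    have "Z n m \<omega> = (\<Sum>j\<in>{1..p n}. \<Sum>k\<in>{1..p n}.
        (c j \<omega> - \<beta> n j) * (c k \<omega> - \<beta> n k) * (\<integral>z. z j * z k \<partial>\<mu> n))" if "\<omega> \<in> space P" for \<omega>
    proof -
      have "fhat n m \<omega> z - f n z = (\<Sum>j\<in>{1..p n}. (c j \<omega> - \<beta> n j) * z j)" for z
        using fhat_c[OF that] by (simp add: f linear_model_def sum_subtractf algebra_simps)
      then show ?thesis
        unfolding Z_def using integral_linear_square[OF \<mu>_int[OF n]] by presburger
    qed
    moreover have "(\<lambda>\<omega>. \<Sum>j\<in>{1..p n}. \<Sum>k\<in>{1..p n}.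
        (c j \<omega> - \<beta> n j) * (c k \<omega> - \<beta> n k) * (\<integral>z. z j * z k \<partial>\<mu> n)) \<in> borel_measurable P"
      using c by (intro borel_measurable_sum borel_measurable_times borel_measurable_diff) auto
    ultimately show ?thesis by (subst measurable_cong) auto
  qed
  \<comment> \<open>Outside \<open>N\<close> and \<open>S\<close> the hypotheses of the deterministic bounds hold almost surely.\<close>
  define N where "N n \<tau> = {\<omega> \<in> space P. \<exists>j\<in>{1..p n}. \<bar>emp_inner n (\<lambda>i. \<epsilon> i \<omega>) (\<lambda>i. X n i \<omega> j)\<bar> \<ge> \<tau>}" for n \<tau>
  define S where "S n \<tau> = {\<omega> \<in> space P. \<exists>j\<in>{1..p n}. \<exists>k\<in>{1..p n}.
      \<bar>emp_inner n (\<lambda>i. X n i \<omega> j) (\<lambda>i. X n i \<omega> k) - (\<integral>z. z j * z k \<partial>\<mu> n)\<bar> \<ge> \<tau>}" for n \<tau>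
  have NS_sets: "N n \<tau> \<in> events" "S n \<tau> \<in> events" if n: "n \<ge> 1" for n \<tau>
  proof -
    have [measurable]: "(\<lambda>\<omega>. emp_inner n (\<lambda>i. \<epsilon> i \<omega>) (\<lambda>i. X n i \<omega> j)) \<in> borel_measurable P"
      if "j \<in> {1..p n}" for j
      unfolding emp_inner_def using Xj[OF n _ that] em
      by (intro borel_measurable_times borel_measurable_sum) auto
    have [measurable]: "(\<lambda>\<omega>. emp_inner n (\<lambda>i. X n i \<omega> j) (\<lambda>i. X n i \<omega> k)) \<in> borel_measurable P"
      if "j \<in> {1..p n}" "k \<in> {1..p n}" for j k
      unfolding emp_inner_def using Xj[OF n _ that(1)] Xj[OF n _ that(2)]
      by (intro borel_measurable_times borel_measurable_sum) auto
    show "N n \<tau> \<in> events" unfolding N_def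
      by (intro sets.sets_Collect_finite_Ex) (simp_all, measurable)
    show "S n \<tau> \<in> events" unfolding S_def
      by (intro sets.sets_Collect_finite_Ex) (simp_all, measurable)
  qed
  have NS_lim: "(\<lambda>n. prob (N n \<tau> \<union> S n \<tau>)) \<longlonglongrightarrow> 0" if \<tau>: "0 < \<tau>" for \<tau>
  proof (rule tendsto_sandwich[OF _ _ tendsto_const])
    have "(\<lambda>n. prob (N n \<tau>)) \<longlonglongrightarrow> 0"
      unfolding N_def
      by (rule noise_correlations_vanish[OF P X_indep X_ident bnd K eps_indep eps_ident eps_centered
          eps_indep_X E1(1,2,4) E4 \<tau>]) auto
    moreover have "(\<lambda>n. prob (S n \<tau>)) \<longlonglongrightarrow> 0"
      unfolding S_def \<mu>_def
      by (rule second_moments_converge_uniformly[OF P X_indep X_ident bnd K E1(1,2,4) \<tau>]) auto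
    ultimately show "(\<lambda>n. prob (N n \<tau>) + prob (S n \<tau>)) \<longlonglongrightarrow> 0"
      by (rule tendsto_add_zero)
    show "\<forall>\<^sub>F n in sequentially. prob (N n \<tau> \<union> S n \<tau>) \<le> prob (N n \<tau>) + prob (S n \<tau>)"
      using eventually_ge_at_top[of 1]
      by eventually_elim (intro measure_Un_le NS_sets)
  qed simp
  have Z_bound: "AE \<omega> in P. \<omega> \<notin> N n \<tau> \<union> S n \<tau> \<longrightarrow>
      Z n (Suc k) \<omega> \<le> 4 * (2 * B + 1)\<^sup>2 / (a * sqrt (harm k)) + (4 * (2 * B + 1)\<^sup>2 + 4) * \<sigma>"
    if n: "n \<ge> 1" and k: "k \<ge> 1" and \<tau>: "0 < \<tau>" "\<tau> \<le> 1" and \<sigma>: "2 ^ k * \<tau> \<le> \<sigma>" "\<sigma> \<le> 1" for n k \<tau> \<sigma>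
  proof -
    have "AE \<omega> in P. \<forall>m. m \<ge> 1 \<longrightarrow> (\<exists>Ct\<ge>a.
      \<bar>emp_inner n (\<lambda>i. R n (m - 1) \<omega> (X n i \<omega>)) (\<lambda>i. baselearner (jhat n m \<omega>) (X n i \<omega>))\<bar>
      \<ge> Ct * (SUP j\<in>{1..p n}.
             \<bar>emp_inner n (\<lambda>i. R n (m - 1) \<omega> (X n i \<omega>)) (\<lambda>i. baselearner j (X n i \<omega>))\<bar>))"
      unfolding AE_all_countable
    proof
      fix m
      show "AE \<omega> in P. m \<ge> 1 \<longrightarrow> (\<exists>Ct\<ge>a.
      \<bar>emp_inner n (\<lambda>i. R n (m - 1) \<omega> (X n i \<omega>)) (\<lambda>i. baselearner (jhat n m \<omega>) (X n i \<omega>))\<bar>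
      \<ge> Ct * (SUP j\<in>{1..p n}.
             \<bar>emp_inner n (\<lambda>i. R n (m - 1) \<omega> (X n i \<omega>)) (\<lambda>i. baselearner j (X n i \<omega>))\<bar>))"
        using E5'[OF n, of m] by (cases "m \<ge> 1") auto
    qed
    moreover have "AE \<omega> in P. normalized_design n (p n) (\<lambda>i. X n i \<omega>)"
      unfolding normalized_design_def by (rule AE_finite_allI) (use normalized[OF n] in auto)
    ultimately show ?thesis
      using AE_space
    proof eventually_elim
      case (elim \<omega>)
      show ?case
      proof
        assume good: "\<omega> \<notin> N n \<tau> \<union> S n \<tau>"
        let ?x = "\<lambda>i. X n i \<omega>" and ?s = "\<lambda>m. jhat n m \<omega>"
        \<comment> \<open>The supremum in the corr-min condition bounds each single correlation, and it is nonnegative.\<close>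
        have greedy: "a * \<bar>emp_inner n (\<lambda>i. R n (m - 1) \<omega> (?x i)) (\<lambda>i. baselearner j (?x i))\<bar>
            \<le> \<bar>emp_inner n (\<lambda>i. R n (m - 1) \<omega> (?x i)) (\<lambda>i. baselearner (?s m) (?x i))\<bar>"
          if m: "m \<ge> 2" and j: "j \<in> {1..p n}" for m j
        proof -
          let ?q = "\<lambda>j. \<bar>emp_inner n (\<lambda>i. R n (m - 1) \<omega> (?x i)) (\<lambda>i. baselearner j (?x i))\<bar>"
          obtain Ct where Ct: "Ct \<ge> a" "?q (?s m) \<ge> Ct * (SUP j\<in>{1..p n}. ?q j)"
            using elim(1) m by (meson one_le_numeral order_trans)
          have sup: "?q j \<le> (SUP j\<in>{1..p n}. ?q j)" by (rule cSUP_upper[OF j]) simp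
          have "a * ?q j \<le> Ct * (SUP j\<in>{1..p n}. ?q j)"
            by (rule mult_mono[OF Ct(1) sup]) (use a Ct(1) in auto)
          with Ct(2) show ?thesis by linarith
        qed
        have noise: "\<bar>emp_inner n (\<lambda>i. \<epsilon> i \<omega>) (\<lambda>i. baselearner j (?x i))\<bar> \<le> \<tau>"
          if "j \<in> {1..p n}" for j
          using good elim(3) that by (auto simp: N_def baselearner_def not_le intro: less_imp_le)
        have dev: "\<bar>emp_inner n (\<lambda>i. ?x i j) (\<lambda>i. ?x i l) - (\<integral>z. z j * z l \<partial>\<mu> n)\<bar> \<le> \<tau>"
          if "j \<in> {1..p n}" "l \<in> {1..p n}" for j l
          using good elim(3) that by (auto simp: S_def not_le intro: less_imp_le)
        define D where "D z = f n z - boost_model 1 n ?x (\<lambda>i. Y n i \<omega>) ?s (Suc k) z" for z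
        have D_ball: "D \<in> l1_ball (p n) ((2 * B + \<tau>) * sqrt (2 * (1 + real k)) + (2 ^ k - 1) * \<tau>)"
          unfolding D_def[abs_def]
          by (rule boosting_error_bounds(1)[where e = "\<lambda>i. \<epsilon> i \<omega>", OF elim(2) jhat_range[OF n _ elim(3)]
              f_ball[OF n] Y[OF n _ elim(3)] noise a greedy[unfolded R]])
        have D_emp: "emp_inner n (\<lambda>i. D (?x i)) (\<lambda>i. D (?x i))
            \<le> 2 * (sqrt 2 * (2 * B + \<tau>)\<^sup>2 / (a * sqrt (harm k))) + 2 * ((2 ^ k - 1) * \<tau>)\<^sup>2"
          unfolding D_def
          by (rule boosting_error_bounds(2)[where e = "\<lambda>i. \<epsilon> i \<omega>", OF elim(2) jhat_range[OF n _ elim(3)]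
              f_ball[OF n] Y[OF n _ elim(3)] noise a greedy[unfolded R]]) (use k in auto)
        have "Z n (Suc k) \<omega> = (\<integral>z. \<bar>D z\<bar>\<^sup>2 \<partial>\<mu> n)"
          unfolding Z_def D_def fhat by (simp add: power2_commute)
        also have "\<dots> \<le> emp_inner n (\<lambda>i. D (?x i)) (\<lambda>i. D (?x i))
            + ((2 * B + \<tau>) * sqrt (2 * (1 + real k)) + (2 ^ k - 1) * \<tau>)\<^sup>2 * \<tau>"
          by (rule l1_ball_moment_deviation[OF D_ball \<mu>_int[OF n] dev]) (use \<tau> in auto)
        also have "\<dots> \<le> 2 * (sqrt 2 * (2 * B + \<tau>)\<^sup>2 / (a * sqrt (harm k))) + 2 * ((2 ^ k - 1) * \<tau>)\<^sup>2
            + ((2 * B + \<tau>) * sqrt (2 * (1 + real k)) + (2 ^ k - 1) * \<tau>)\<^sup>2 * \<tau>"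
          using D_emp by simp
        also have "\<dots> \<le> 4 * (2 * B + 1)\<^sup>2 / (a * sqrt (harm k)) + (4 * (2 * B + 1)\<^sup>2 + 4) * \<sigma>"
          by (rule boosting_error_rate) (use a B0 \<tau> \<sigma> in auto)
        finally show "Z n (Suc k) \<omega> \<le> 4 * (2 * B + 1)\<^sup>2 / (a * sqrt (harm k)) + (4 * (2 * B + 1)\<^sup>2 + 4) * \<sigma>" .
      qed
    qed
  qed
  \<comment> \<open>With \<open>\<tau> = 4\<^sup>-\<^sup>r\<close> and \<open>k \<le> r\<close> the accumulated noise \<open>2\<^sup>k\<tau>\<close> is at most \<open>2\<^sup>-\<^sup>r\<close>.\<close>
  define \<tau> where "\<tau> r = (1 / 4 :: real) ^ r" for r :: nat
  define bad where "bad r n = N n (\<tau> r) \<union> S n (\<tau> r)" for r n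
  have "\<forall>\<^sub>F n in sequentially. prob (bad k n) \<le> 1 / real (Suc k)" for k
    unfolding bad_def
    using order_tendstoD(2)[OF NS_lim[of "\<tau> k"], of "1 / real (Suc k)"]
    by (auto simp: \<tau>_def elim!: eventually_mono)
  then obtain r :: "nat \<Rightarrow> nat" where r: "filterlim r at_top sequentially"
    and r_bad: "\<forall>\<^sub>F n in sequentially. prob (bad (r n) n) \<le> 1 / real (Suc (r n))"
    by (rule diagonal_sequence)
  show ?thesis
  proof (intro exI[of _ r] conjI r allI impI)
    fix m :: "nat \<Rightarrow> nat" assume m: "filterlim m at_top sequentially" and m_le: "\<forall>n. m n \<le> r n"
    \<comment> \<open>Of the \<open>m n\<close> iterations, all but the first are steps of the greedy algorithm.\<close>
    define b where "b n = 4 * (2 * B + 1)\<^sup>2 / (a * sqrt (harm (m n - 1)))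
      + (4 * (2 * B + 1)\<^sup>2 + 4) * (1 / 2) ^ r n" for n
    have b_lim: "b \<longlonglongrightarrow> 0"
    proof -
      have m1: "filterlim (\<lambda>n. m n - 1) at_top sequentially"
        unfolding filterlim_at_top
      proof
        fix c :: nat
        from m have "\<forall>\<^sub>F n in sequentially. c + 1 \<le> m n" by (simp add: filterlim_at_top)
        then show "\<forall>\<^sub>F n in sequentially. c \<le> m n - 1" by eventually_elim simp
      qed
      have h: "filterlim (\<lambda>n. sqrt (harm (m n - 1)) :: real) at_top sequentially"
        by (rule filterlim_compose[OF sqrt_at_top filterlim_compose[OF harm_at_top m1]])
      have 1: "(\<lambda>n. 4 * (2 * B + 1)\<^sup>2 / (a * sqrt (harm (m n - 1)))) \<longlonglongrightarrow> 0"
        by (rule real_tendsto_divide_at_top[OF tendsto_const])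
          (rule filterlim_tendsto_pos_mult_at_top[OF tendsto_const a h])
      have "(\<lambda>k. (1 / 2 :: real) ^ k) \<longlonglongrightarrow> 0" by (rule LIMSEQ_power_zero) simp
      then have 2: "(\<lambda>n. (1 / 2 :: real) ^ r n) \<longlonglongrightarrow> 0" by (rule filterlim_compose[OF _ r])
      from tendsto_add[OF 1 tendsto_mult[OF tendsto_const 2, of "4 * (2 * B + 1)\<^sup>2 + 4"]]
      show ?thesis unfolding b_def by simp
    qed
    show "small_o_P_one P (\<lambda>n \<omega>.
        \<integral>x. \<bar>fhat n (m n) \<omega> x - f n x\<bar>\<^sup>2 \<partial>(distr P (covar_space (p n)) (Xnew n)))"
      unfolding small_o_P_one_def
    proof (intro conjI allI impI)
      show "\<forall>\<^sub>F n in sequentially. (\<lambda>\<omega>. \<integral>x. \<bar>fhat n (m n) \<omega> x - f n x\<bar>\<^sup>2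
          \<partial>(distr P (covar_space (p n)) (Xnew n))) \<in> borel_measurable P"
        using eventually_ge_at_top[of 1]
        by eventually_elim (simp only: Z_eq Z_meas)
      fix \<eta> :: real assume \<eta>: "\<eta> > 0"
      show "(\<lambda>n. prob {\<omega> \<in> space P. \<bar>\<integral>x. \<bar>fhat n (m n) \<omega> x - f n x\<bar>\<^sup>2
          \<partial>(distr P (covar_space (p n)) (Xnew n))\<bar> > \<eta>}) \<longlonglongrightarrow> 0"
      proof (rule tendsto_sandwich[OF _ _ tendsto_const])
        show "(\<lambda>n. 1 / real (Suc (r n))) \<longlonglongrightarrow> 0"
          using filterlim_compose[OF LIMSEQ_inverse_real_of_nat r] by (simp add: inverse_eq_divide)
        have "\<forall>\<^sub>F n in sequentially. m n \<ge> 2" using m by (simp add: filterlim_at_top)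
        with eventually_ge_at_top[of 1] r_bad order_tendstoD(2)[OF b_lim \<eta>]
        show "\<forall>\<^sub>F n in sequentially. prob {\<omega> \<in> space P. \<bar>\<integral>x. \<bar>fhat n (m n) \<omega> x - f n x\<bar>\<^sup>2
            \<partial>(distr P (covar_space (p n)) (Xnew n))\<bar> > \<eta>} \<le> 1 / real (Suc (r n))"
        proof eventually_elim
          case (elim n)
          define k where "k = m n - 1"
          have k: "m n = Suc k" "k \<ge> 1" "k \<le> r n" using elim(4) m_le[rule_format, of n] by (auto simp: k_def)
          have "2 ^ k * \<tau> (r n) \<le> 2 ^ r n * \<tau> (r n)"
            using k(3) by (intro mult_right_mono power_increasing) (auto simp: \<tau>_def)
          also have "\<dots> = (1 / 2) ^ r n" by (simp add: \<tau>_def flip: power_mult_distrib)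
          finally have "AE \<omega> in P. \<omega> \<notin> bad (r n) n \<longrightarrow> Z n (m n) \<omega> \<le> b n"
            unfolding bad_def b_def k_def[symmetric] unfolding k(1)
            by (intro Z_bound[OF elim(1) k(2)]) (auto simp: \<tau>_def power_le_one)
          then have "AE \<omega> in P. \<omega> \<in> {\<omega> \<in> space P. \<bar>Z n (m n) \<omega>\<bar> > \<eta>} \<longrightarrow> \<omega> \<in> bad (r n) n"
          proof eventually_elim
            case (elim \<omega>)
            have "0 \<le> Z n (m n) \<omega>" by (simp add: Z_def)
            with elim \<open>b n < \<eta>\<close> show ?case by auto
          qed
          then have "prob {\<omega> \<in> space P. \<bar>Z n (m n) \<omega>\<bar> > \<eta>} \<le> prob (bad (r n) n)"
            by (rule finite_measure_mono_AE) (use NS_sets[OF elim(1)] in \<open>auto simp: bad_def\<close>)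
          then show ?case unfolding Z_eq[OF elim(1)] using elim(2) by (rule order_trans)
        qed
      qed simp
    qed
  qed
qed

end
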